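(* For every integer $k\ge 0$, the Todd symmetric function $T_k$ is expressed in terms of the symmetric functions $g_\lambda$ by $$T_k=(-1)^k\sum_{\lambda:\ |\lambda|=k}\frac{g_\lambda}{(\lambda_1+1)\cdots(\lambda_l+1)},$$ where the sum is over all partitions $\lambda=(\lambda_1,\dots,\lambda_l)$ of $k$.
   Context: Let $\Lambda$ be the graded ring of symmetric functions over $\mathbb Z$ in variables $x_1,x_2,\dots$, with elementary symmetric functions $e_k$, complete symmetric functions $h_k$ and monomial symmetric functions $m_\lambda$ ($\lambda$ a partition). Let $\omega:\Lambda\to\Lambda$ be the standard ring involution determined by $\omega(e_k)=h_k$ for all $k$. The forgotten symmetric functions are $f_\lambda=\omega(m_\lambda)$. The Todd polynomials $T_k(c_1,\dots,c_n)$ are defined by $$\prod_{i=1}^n\frac{tx_i}{1-e^{-tx_i}}=\sum_{k\ge0}T_k(c_1,\dots,c_n)\,t^k,$$ where $c_j=e_j(x_1,\dots,x_n)$. The Todd symmetric function $T_k\in\Lambda^k\otimes\mathbb Q$ is the unique homogeneous symmetric function of degree $k$ with rational coefficients whose image under setting $x_i=0$ for all $i>k$ is $T_k(c_1,\dots,c_k)$ with $c_j=e_j(x_1,\dots,x_k)$. Definition of $g_\lambda$. Let $a_1,a_2,\dots$ be indeterminates and let $b_1,b_2,\dots\in\mathbb Z[a_1,a_2,\dots]$ be defined by requiring that $\beta(v)=v+\sum_{n\ge1}b_nv^{n+1}$ be the compositional inverse of $\alpha(u)=u+\sum_{n\ge1}a_nu^{n+1}$ (so $b_1=-a_1$, $b_2=-a_2+2a_1^2$,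 etc.). For a partition $\lambda=(\lambda_1,\dots,\lambda_l)$ put $a^\lambda=a_{\lambda_1}\cdots a_{\lambda_l}$ and $b^\lambda=b_{\lambda_1}\cdots b_{\lambda_l}$, and define integers $C^\lambda_\mu$ (for partitions $\lambda,\mu$ with $|\lambda|=|\mu|$) by $b^\lambda=\sum_{\mu}C^\lambda_\mu a^\mu$. Then $$g_\lambda=\sum_{\mu:\ |\mu|=|\lambda|}C^\mu_\lambda f_\mu,$$ where $C_\lambda^\mu$ is the coefficient of $a^\lambda$ in $b^\mu$. *)

theory Defs
  imports
    "HOL-Library.Poly_Mapping"
    "HOL-Library.Multiset"
    "HOL-Library.FuncSet"
    "HOL-Computational_Algebra.Formal_Power_Series"
begin

section \<open>Monomials\<close>

text \<open>
  A monomial in countably many indeterminates is its finitely supported exponent vector, of type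
  \<open>nat \<Rightarrow>\<^sub>0 nat\<close>; polynomials are elements of \<open>(nat \<Rightarrow>\<^sub>0 nat) \<Rightarrow>\<^sub>0 'a\<close>.
\<close>

type_synonym monom = "nat \<Rightarrow>\<^sub>0 nat"

type_synonym 'a mpoly = "monom \<Rightarrow>\<^sub>0 'a"

definition mdeg :: "monom \<Rightarrow> nat" where
  "mdeg p = (\<Sum>i\<in>Poly_Mapping.keys p. Poly_Mapping.lookup p i)"

definition mvar :: "nat \<Rightarrow> 'a::comm_ring_1 mpoly" where
  "mvar i = Poly_Mapping.single (Poly_Mapping.single i 1) 1"

definition mconst :: "'a \<Rightarrow> 'a::comm_ring_1 mpoly" where
  "mconst c = Poly_Mapping.single 0 c"

lemma mdeg_superset:
  assumes "finite A" "Poly_Mapping.keys p \<subseteq> A"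
  shows "mdeg p = (\<Sum>i\<in>A. Poly_Mapping.lookup p i)"
  unfolding mdeg_def using assms by (intro sum.mono_neutral_left) (auto simp: in_keys_iff)

lemma mdeg_0 [simp]: "mdeg 0 = 0"
  by (simp add: mdeg_def)

lemma mdeg_add: "mdeg (p + q) = mdeg p + mdeg q"
proof -
  let ?A = "Poly_Mapping.keys p \<union> Poly_Mapping.keys q"
  have *: "Poly_Mapping.keys (p + q) \<subseteq> ?A"
    by (rule Poly_Mapping.keys_add)
  show ?thesis
    using * by (simp add: mdeg_superset[of ?A] lookup_add sum.distrib)
qed

lemma lookup_le_mdeg: "Poly_Mapping.lookup p i \<le> mdeg p"
proof (cases "i \<in> Poly_Mapping.keys p")
  case True
  then show ?thesis unfolding mdeg_def by (intro member_le_sum) auto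
qed (simp add: in_keys_iff)

lemma finite_bounded_monoms:
  assumes "finite A"
  shows "finite {p :: monom. Poly_Mapping.keys p \<subseteq> A \<and> mdeg p \<le> d}" (is "finite ?S")
proof (rule finite_imageD)
  show "finite ((\<lambda>p. restrict (Poly_Mapping.lookup p) A) ` ?S)"
  proof (rule finite_subset)
    show "(\<lambda>p. restrict (Poly_Mapping.lookup p) A) ` ?S \<subseteq> A \<rightarrow>\<^sub>E {..d}"
      by (auto intro: order_trans[OF lookup_le_mdeg])
    show "finite (A \<rightarrow>\<^sub>E {..d})" using assms by (intro finite_PiE) auto
  qed
  show "inj_on (\<lambda>p. restrict (Poly_Mapping.lookup p) A) ?S"
  proof (rule inj_onI, rule poly_mapping_eqI)
    fix p q :: monom and i
    assume pq: "p \<in> ?S" "q \<in> ?S"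
      and eq: "restrict (Poly_Mapping.lookup p) A = restrict (Poly_Mapping.lookup q) A"
    show "Poly_Mapping.lookup p i = Poly_Mapping.lookup q i"
    proof (cases "i \<in> A")
      case True
      then show ?thesis using fun_cong[OF eq, of i] by simp
    next
      case False
      then have "i \<notin> Poly_Mapping.keys p" "i \<notin> Poly_Mapping.keys q" using pq by auto
      then show ?thesis by (simp add: in_keys_iff)
    qed
  qed
qed

lemma finite_monom_splits: "finite {(q, r). q + r = (p :: monom)}"
proof (rule finite_subset)
  let ?S = "{q :: monom. Poly_Mapping.keys q \<subseteq> Poly_Mapping.keys p \<and> mdeg q \<le> mdeg p}"
  show "{(q, r). q + r = p} \<subseteq> ?S \<times> ?S"
    by (auto simp: mdeg_add in_keys_iff lookup_add)
  show "finite (?S \<times> ?S)"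
    by (intro finite_cartesian_product finite_bounded_monoms finite_keys)
qed

definition mperm :: "(nat \<Rightarrow> nat) \<Rightarrow> monom \<Rightarrow> monom" where
  "mperm \<pi> p = Poly_Mapping.map_key \<pi> p"

lemma lookup_mperm: "bij \<pi> \<Longrightarrow> Poly_Mapping.lookup (mperm \<pi> p) i = Poly_Mapping.lookup p (\<pi> i)"
  unfolding mperm_def by (simp add: map_key.rep_eq bij_is_inj)

lemma mperm_add: "bij \<pi> \<Longrightarrow> mperm \<pi> (p + q) = mperm \<pi> p + mperm \<pi> q"
  by (rule poly_mapping_eqI) (simp add: lookup_mperm lookup_add)

lemma mperm_inv:
  assumes "bij \<pi>"
  shows "mperm \<pi> (mperm (inv \<pi>) p) = p" "mperm (inv \<pi>) (mperm \<pi> p) = p"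
  using assms bij_imp_bij_inv[OF assms]
  by (auto intro!: poly_mapping_eqI simp: lookup_mperm bij_is_inj bij_is_surj surj_f_inv_f)

lemma keys_mperm: "bij \<pi> \<Longrightarrow> Poly_Mapping.keys (mperm \<pi> p) = \<pi> -` Poly_Mapping.keys p"
  by (auto simp: in_keys_iff lookup_mperm)

lemma bij_betw_keys_mperm:
  assumes "bij \<pi>"
  shows "bij_betw \<pi> (Poly_Mapping.keys (mperm \<pi> p)) (Poly_Mapping.keys p)"
  using assms unfolding keys_mperm[OF assms]
  by (auto simp: bij_betw_def inj_on_def bij_def surj_image_vimage_eq)

lemma mperm_0 [simp]: "bij \<pi> \<Longrightarrow> mperm \<pi> 0 = 0"
  by (rule poly_mapping_eqI) (simp add: lookup_mperm)

lemma mperm_eq_0_iff [simp]: "bij \<pi> \<Longrightarrow> mperm \<pi> p = 0 \<longleftrightarrow> p = 0"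
  by (metis mperm_0 mperm_inv(2) bij_imp_bij_inv)

lemma mdeg_mperm: "bij \<pi> \<Longrightarrow> mdeg (mperm \<pi> p) = mdeg p"
  unfolding mdeg_def using sum.reindex_bij_betw[OF bij_betw_keys_mperm, of \<pi> "Poly_Mapping.lookup p" p]
  by (simp add: lookup_mperm)

definition mshape :: "monom \<Rightarrow> nat multiset" where
  "mshape p = image_mset (Poly_Mapping.lookup p) (mset_set (Poly_Mapping.keys p))"

lemma mshape_mperm: 
  assumes "bij \<pi>"
  shows "mshape (mperm \<pi> p) = mshape p"
proof -
  have "image_mset \<pi> (mset_set (Poly_Mapping.keys (mperm \<pi> p))) = mset_set (Poly_Mapping.keys p)"
    using bij_betw_keys_mperm[OF assms, of p] by (auto simp: bij_betw_def image_mset_mset_set)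
  then have "mshape p = image_mset (\<lambda>i. Poly_Mapping.lookup p (\<pi> i))
      (mset_set (Poly_Mapping.keys (mperm \<pi> p)))"
    unfolding mshape_def by (metis (no_types, lifting) image_mset.compositionality comp_apply image_mset_cong)
  then show ?thesis
    using assms by (simp add: mshape_def lookup_mperm cong: image_mset_cong)
qed

lemma sum_mset_mshape: "sum_mset (mshape p) = mdeg p"
  by (simp add: mshape_def mdeg_def sum_unfold_sum_mset)


section \<open>The ring of symmetric functions\<close>

text \<open>
  Formal power series of bounded degree in countably many variables, given by their coefficients
  and invariant under permutation of the variables. The variable \<open>x\<^sub>i\<close> for \<open>i \<ge> 1\<close> has index
  \<open>i - 1\<close>. The instance at \<open>int\<close> is the ring \<open>\<Lambda>\<close>; the one at \<open>rat\<close> is its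
  tensor product with the rationals, the degree being bounded.
\<close>

typedef (overloaded) 'a::comm_ring_1 symfun =
  "{F :: monom \<Rightarrow> 'a. (\<forall>\<pi> p. bij \<pi> \<longrightarrow> F (mperm \<pi> p) = F p) \<and> (\<exists>d. \<forall>p. F p \<noteq> 0 \<longrightarrow> mdeg p \<le> d)}"
  morphisms sf_coeff Abs_symfun
  by (rule exI[of _ "\<lambda>_. 0"]) simp

setup_lifting type_definition_symfun

lemma sf_eqI: "(\<And>p. sf_coeff F p = sf_coeff G p) \<Longrightarrow> F = G"
  by (simp add: sf_coeff_inject[symmetric] fun_eq_iff)

instantiation symfun :: (comm_ring_1) comm_ring_1
begin

lift_definition zero_symfun :: "'a symfun" is "\<lambda>_. 0"
  by simp

lift_definition one_symfun :: "'a symfun" is "\<lambda>p. if p = 0 then 1 else 0"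
  by (auto intro!: exI[of _ 0])

lift_definition plus_symfun :: "'a symfun \<Rightarrow> 'a symfun \<Rightarrow> 'a symfun" is "\<lambda>F G p. F p + G p"
proof (goal_cases)
  case (1 F G)
  then obtain d e where "\<forall>p. F p \<noteq> 0 \<longrightarrow> mdeg p \<le> d" "\<forall>p. G p \<noteq> 0 \<longrightarrow> mdeg p \<le> e"
    by blast
  then have "\<forall>p. F p + G p \<noteq> 0 \<longrightarrow> mdeg p \<le> max d e"
    by (metis add.right_neutral le_max_iff_disj)
  with 1 show ?case by auto
qed

lift_definition uminus_symfun :: "'a symfun \<Rightarrow> 'a symfun" is "\<lambda>F p. - F p"
  by auto

lift_definition minus_symfun :: "'a symfun \<Rightarrow> 'a symfun \<Rightarrow> 'a symfun" is "\<lambda>F G p. F p - G p"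
proof (goal_cases)
  case (1 F G)
  then obtain d e where "\<forall>p. F p \<noteq> 0 \<longrightarrow> mdeg p \<le> d" "\<forall>p. G p \<noteq> 0 \<longrightarrow> mdeg p \<le> e"
    by blast
  then have "\<forall>p. F p - G p \<noteq> 0 \<longrightarrow> mdeg p \<le> max d e"
    by (metis diff_zero le_max_iff_disj)
  with 1 show ?case by auto
qed

lift_definition times_symfun :: "'a symfun \<Rightarrow> 'a symfun \<Rightarrow> 'a symfun" is
  "\<lambda>F G p. \<Sum>(q, r) | q + r = p. F q * G r"
proof (goal_cases)
  case (1 F G)
  then obtain d e where d: "\<And>p. F p \<noteq> 0 \<Longrightarrow> mdeg p \<le> d" and e: "\<And>p. G p \<noteq> 0 \<Longrightarrow> mdeg p \<le> e"
    by blast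
  have "(\<Sum>(q, r) | q + r = mperm \<pi> p. F q * G r) = (\<Sum>(q, r) | q + r = p. F q * G r)"
    if "bij \<pi>" for \<pi> p
  proof -
    note [simp] = \<open>bij \<pi>\<close> bij_imp_bij_inv[OF \<open>bij \<pi>\<close>] mperm_inv[OF \<open>bij \<pi>\<close>]
    let ?i = "\<lambda>(q, r). (mperm \<pi> q, mperm \<pi> r)"
    let ?j = "\<lambda>(q, r). (mperm (inv \<pi>) q, mperm (inv \<pi>) r)"
    show ?thesis
    proof (rule sum.reindex_bij_witness[of _ ?i ?j])
      show "?i (?j a) = a" for a by (cases a) simp
      show "?j (?i b) = b" for b by (cases b) simp
      show "?j a \<in> {(q, r). q + r = p}" if "a \<in> {(q, r). q + r = mperm \<pi> p}" for a
        using that by (auto simp: mperm_add[symmetric])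
      show "?i b \<in> {(q, r). q + r = mperm \<pi> p}" if "b \<in> {(q, r). q + r = p}" for b
        using that by (auto simp: mperm_add[symmetric])
      show "(case ?j a of (q, r) \<Rightarrow> F q * G r) = (case a of (q, r) \<Rightarrow> F q * G r)" for a
        using 1 by (cases a) simp
    qed
  qed
  moreover have "mdeg p \<le> d + e" if nz: "(\<Sum>(q, r) | q + r = p. F q * G r) \<noteq> 0" for p
  proof -
    from nz obtain q r where qr: "q + r = p" and "F q * G r \<noteq> 0"
      by (auto elim!: sum.not_neutral_contains_not_neutral)
    then have "F q \<noteq> 0" "G r \<noteq> 0" by auto
    then show ?thesis using d[of q] e[of r] qr by (auto simp: mdeg_add)
  qed
  ultimately show ?case by blast
qed

instance
proof
  fix F G H :: "'a symfun"
  show "F + G + H = F + (G + H)" "F + G = G + F" "0 + F = F" "- F + F = 0" "F - G = F + - G"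
    by (transfer; simp add: fun_eq_iff algebra_simps)+
  show "(0 :: 'a symfun) \<noteq> 1"
    by transfer (auto simp: fun_eq_iff)
  show "F * G = G * F"
  proof (transfer, rule ext)
    fix F G :: "monom \<Rightarrow> 'a" and p
    show "(\<Sum>(q, r) | q + r = p. F q * G r) = (\<Sum>(q, r) | q + r = p. G q * F r)"
      by (rule sum.reindex_bij_witness[of _ prod.swap prod.swap]) (auto simp: algebra_simps)
  qed
  show "1 * F = F"
  proof (transfer, rule ext)
    fix F :: "monom \<Rightarrow> 'a" and p
    have "(\<Sum>(q, r) | q + r = p. (if q = 0 then 1 else 0) * F r) = (\<Sum>(q, r)\<in>{(0 :: monom, p)}. F r)"
      by (rule sum.mono_neutral_cong_right[OF finite_monom_splits]) (auto split: if_splits)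
    then show "(\<Sum>(q, r) | q + r = p. (if q = 0 then 1 else 0) * F r) = F p"
      by simp
  qed
  show "(F + G) * H = F * H + G * H"
    by transfer (simp add: fun_eq_iff distrib_right sum.distrib case_prod_unfold)
  show "F * G * H = F * (G * H)"
  proof (transfer, rule ext)
    fix F G H :: "monom \<Rightarrow> 'a" and p
    let ?D = "\<lambda>p. {(q, r). q + r = (p :: monom)}"
    have "(\<Sum>(q, r)\<in>?D p. (\<Sum>(s, t)\<in>?D q. F s * G t) * H r)
        = (\<Sum>(a, b)\<in>Sigma (?D p) (\<lambda>a. ?D (fst a)). F (fst b) * G (snd b) * H (snd a))"
      by (simp add: sum.Sigma finite_monom_splits[unfolded case_prod_unfold] sum_distrib_right case_prod_unfold)
    also have "\<dots> = (\<Sum>(a, b)\<in>Sigma (?D p) (\<lambda>a. ?D (snd a)). F (fst a) * G (fst b) * H (snd b))"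
      by (rule sum.reindex_bij_witness[of _
            "\<lambda>(a, b). ((fst a + fst b, snd b), (fst a, fst b))"
            "\<lambda>(a, b). ((fst b, snd b + snd a), (snd b, snd a))"]) (auto simp: add.assoc)
    also have "\<dots> = (\<Sum>(q, r)\<in>?D p. F q * (\<Sum>(s, t)\<in>?D r. G s * H t))"
      by (simp add: sum.Sigma finite_monom_splits[unfolded case_prod_unfold] sum_distrib_left case_prod_unfold
          mult.assoc)
    finally show "(\<Sum>(q, r)\<in>?D p. (\<Sum>(s, t)\<in>?D q. F s * G t) * H r)
        = (\<Sum>(q, r)\<in>?D p. F q * (\<Sum>(s, t)\<in>?D r. G s * H t))" .
  qed
qed

end

lift_definition sf_scale :: "'a \<Rightarrow> 'a::comm_ring_1 symfun \<Rightarrow> 'a symfun" is "\<lambda>c F p. c * F p"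
  by (metis mult_zero_right)

lift_definition sf_rat :: "int symfun \<Rightarrow> rat symfun" is "\<lambda>F p. of_int (F p)"
  by auto

definition sf_homogeneous :: "nat \<Rightarrow> 'a::comm_ring_1 symfun \<Rightarrow> bool" where
  "sf_homogeneous k F \<longleftrightarrow> (\<forall>p. sf_coeff F p \<noteq> 0 \<longrightarrow> mdeg p = k)"

text \<open>The image of \<open>F\<close> under setting \<open>x\<^sub>i = 0\<close> for all \<open>i > n\<close>, a polynomial in \<open>x\<^sub>1, \<dots>, x\<^sub>n\<close>.\<close>

lift_definition sf_restrict :: "nat \<Rightarrow> 'a::comm_ring_1 symfun \<Rightarrow> 'a mpoly" is
  "\<lambda>n F p. if Poly_Mapping.keys p \<subseteq> {..<n} then F p else 0"
proof (goal_cases)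
  case (1 n F)
  then obtain d where "\<forall>p. F p \<noteq> 0 \<longrightarrow> mdeg p \<le> d" by blast
  then have "{p. (if Poly_Mapping.keys p \<subseteq> {..<n} then F p else 0) \<noteq> 0}
      \<subseteq> {p. Poly_Mapping.keys p \<subseteq> {..<n} \<and> mdeg p \<le> d}"
    by auto
  then show ?case by (rule finite_subset) (simp add: finite_bounded_monoms)
qed


section \<open>Partitions and the classical families\<close>

text \<open>A partition is the multiset of its (positive) parts.\<close>

definition partitions :: "nat \<Rightarrow> nat multiset set" where
  "partitions k = {\<nu>. 0 \<notin># \<nu> \<and> sum_mset \<nu> = k}"

lemma finite_partitions: "finite (partitions k)"
proof (rule finite_subset)
  let ?S = "(\<Union>n\<le>k. {xs. set xs \<subseteq> {..k} \<and> length xs = n})"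
  show "finite (mset ` ?S)"
    by (intro finite_imageI finite_UN_I finite_lists_length_eq) auto
  show "partitions k \<subseteq> mset ` ?S"
  proof
    fix l assume l: "l \<in> partitions k"
    obtain xs where xs: "mset xs = l" using ex_mset by blast
    from l xs have "0 \<notin> set xs" "sum_list xs = k"
      by (auto simp: partitions_def sum_mset_sum_list)
    moreover from this have "length xs \<le> k"
    proof (induction xs arbitrary: k)
      case (Cons x xs)
      then show ?case by (cases x) force+
    qed simp
    moreover have "x \<le> sum_list xs" if "x \<in> set xs" for x
      using that by (intro member_le_sum_list) auto
    ultimately show "l \<in> mset ` ?S" using xs by auto
  qed
qed

lift_definition sf_e :: "nat \<Rightarrow> 'a::comm_ring_1 symfun" is
  "\<lambda>k p. if mdeg p = k \<and> (\<forall>i. Poly_Mapping.lookup p i \<le> 1) then 1 else 0"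
proof (goal_cases)
  case (1 k)
  have "(\<forall>i. Poly_Mapping.lookup (mperm \<pi> p) i \<le> 1) \<longleftrightarrow> (\<forall>i. Poly_Mapping.lookup p i \<le> 1)"
    if "bij \<pi>" for \<pi> and p :: monom
    using that by (metis lookup_mperm bij_pointE)
  then show ?case by (auto simp: mdeg_mperm)
qed

lift_definition sf_h :: "nat \<Rightarrow> 'a::comm_ring_1 symfun" is
  "\<lambda>k p. if mdeg p = k then 1 else 0"
  by (auto simp: mdeg_mperm)

text \<open>Here \<^term>\<open>mshape p\<close> is the multiset of nonzero exponents of the monomial \<open>p\<close>.\<close>

lift_definition sf_m :: "nat multiset \<Rightarrow> 'a::comm_ring_1 symfun" is
  "\<lambda>\<nu> p. if mshape p = \<nu> then 1 else 0"
  by (auto simp: mshape_mperm sum_mset_mshape[symmetric])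

definition omega :: "int symfun \<Rightarrow> int symfun" where
  "omega = (THE w. w 1 = 1 \<and> (\<forall>F G. w (F + G) = w F + w G) \<and> (\<forall>F G. w (F * G) = w F * w G)
      \<and> (\<forall>k. w (sf_e k) = sf_h k))"

definition forgotten :: "nat multiset \<Rightarrow> int symfun" where
  "forgotten \<nu> = omega (sf_m \<nu>)"


section \<open>Todd symmetric functions\<close>

text \<open>
  Univariate power series are in the variable \<open>t\<close>. With \<open>td(u) = u / (1 - e\<^sup>-\<^sup>u)\<close> as a power series
  over the rationals, the factor for \<open>x\<close> is \<open>td(t x) = t x / (1 - e\<^sup>-\<^sup>t\<^sup>x)\<close>.
\<close>

definition td_series :: "rat fps" where
  "td_series = fps_X / (1 - fps_exp (-1))"

definition todd_factor :: "rat mpoly \<Rightarrow> rat mpoly fps" where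
  "todd_factor x = Abs_fps (\<lambda>j. mconst (fps_nth td_series j) * x ^ j)"

text \<open>
  The value of the Todd polynomial \<open>T\<^sub>k(c\<^sub>1, \<dots>, c\<^sub>n)\<close> at \<open>c\<^sub>j = e\<^sub>j(x\<^sub>1, \<dots>, x\<^sub>n)\<close>, which is how
  that polynomial is defined.
\<close>

definition todd_poly :: "nat \<Rightarrow> nat \<Rightarrow> rat mpoly" where
  "todd_poly n k = fps_nth (\<Prod>i<n. todd_factor (mvar i)) k"

definition todd :: "nat \<Rightarrow> rat symfun" where
  "todd k = (THE F. sf_homogeneous k F \<and> sf_restrict k F = todd_poly k k)"


section \<open>The symmetric functions \<open>g\<close>\<close>

text \<open>The indeterminate \<open>a\<^sub>n\<close> is \<^term>\<open>mvar n\<close>, \<open>n \<ge> 1\<close>; \<^term>\<open>mvar 0\<close> does not occur.\<close>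

definition alpha :: "int mpoly fps" where
  "alpha = Abs_fps (\<lambda>n. if n = 0 then 0 else if n = 1 then 1 else mvar (n - 1))"

definition beta :: "int mpoly fps" where
  "beta = (THE B. fps_nth B 0 = 0 \<and> fps_nth B 1 = 1 \<and> alpha oo B = fps_X \<and> B oo alpha = fps_X)"

definition b_coeff :: "nat \<Rightarrow> int mpoly" where
  "b_coeff n = fps_nth beta (n + 1)"

text \<open>\<open>C_coeff \<nu> \<mu>\<close> is \<open>C\<^sup>\<nu>\<^sub>\<mu>\<close>, the coefficient of \<open>a\<^sup>\<mu>\<close> in \<open>b\<^sup>\<nu>\<close>.\<close>

definition C_coeff :: "nat multiset \<Rightarrow> nat multiset \<Rightarrow> int" where
  "C_coeff \<nu> \<mu> = Poly_Mapping.lookup (\<Prod>i\<in>#\<nu>. b_coeff i) (\<Sum>i\<in>#\<mu>. Poly_Mapping.single i 1)"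

definition g_sym :: "nat multiset \<Rightarrow> int symfun" where
  "g_sym \<nu> = (\<Sum>\<mu>\<in>partitions (sum_mset \<nu>). of_int (C_coeff \<mu> \<nu>) * forgotten \<mu>)"

end

theory Submission
  imports Defs "HOL-Combinatorics.Transposition"
    "HOL-Computational_Algebra.Fundamental_Theorem_Algebra"
    "HOL-Computational_Algebra.Polynomial_FPS"
begin

text \<open>
  A power series \<open>\<phi>\<close> with constant term 1 has a multiplicative sequence, the symmetric functions
  \<open>K\<^sub>k(\<phi>)\<close> of degree \<open>k\<close> that are the graded pieces of \<open>\<phi>(x\<^sub>1) \<phi>(x\<^sub>2) \<cdots>\<close>. The coefficient of \<open>K\<^sub>k(\<phi>)\<close> at a
  monomial is the product of the coefficients of \<open>\<phi>\<close> at its exponents, so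
  \<open>K\<^sub>k(\<phi>) = \<Sum>\<^bsub>|\<mu>| = k\<^esub> \<phi>\<^sup>\<mu> m\<^sub>\<mu>\<close> with \<open>\<phi>\<^sup>\<mu> = \<phi>\<^sub>\<mu>\<^sub>1 \<phi>\<^sub>\<mu>\<^sub>2 \<cdots>\<close> (\<open>mult_seq_eq_sum_m\<close>). The Todd symmetric function
  is \<open>K\<^sub>k(td)\<close> for \<open>td = X / (1 - e\<^sup>-\<^sup>X)\<close> (\<open>todd_eq_mult_seq\<close>).

  Interchanging the two summations on the right-hand side turns it into
  \<open>(-1)\<^sup>k \<Sum>\<^sub>\<mu> f\<^sub>\<mu> \<Sum>\<^sub>\<nu> C\<^sup>\<mu>\<^sub>\<nu> / \<Prod>(\<nu>\<^sub>i + 1)\<close>. The inner sum is the value of \<open>b\<^sup>\<mu>\<close> at \<open>a\<^sub>n = 1/(n + 1)\<close>. For these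
  values \<open>\<alpha>(u) = -log(1 - u)\<close>, hence \<open>\<beta>(v) = 1 - e\<^sup>-\<^sup>v\<close> and \<open>b\<^sub>n = (-1)\<^sup>n / (n + 1)!\<close>
  (\<open>log_spec_b_coeff\<close>). The signs combine to \<open>(-1)\<^sup>k\<close>, and what remains is the sum of \<open>\<phi>\<^sup>\<mu> f\<^sub>\<mu>\<close> with
  \<open>\<phi> = (e\<^sup>X - 1) / X\<close>, which is \<open>\<omega>(K\<^sub>k(\<phi>))\<close>.

  So the theorem reduces to the rule that \<open>\<omega>\<close> carries the multiplicative sequence of \<open>\<phi>(X)\<close> to that of
  \<open>1/\<phi>(-X)\<close>, because \<open>1/\<phi>(-X) = td\<close> for this \<open>\<phi>\<close>. For \<open>\<phi> = 1 + y X\<close> the rule is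
  \<open>\<omega>(e\<^sub>k) = h\<^sub>k\<close>, and both of its sides are multiplicative in \<open>\<phi>\<close>. Over the complex numbers
  every polynomial with constant term 1 is a product of factors \<open>1 + y X\<close>, and \<open>K\<^sub>k(\<phi>)\<close> depends only
  on \<open>\<phi>\<close> modulo \<open>X\<^sup>k\<^sup>+\<^sup>1\<close>, so the rule holds for every complex power series with constant term 1
  (\<open>omega_mult_seq\<close>). A rational identity can be checked after embedding the rationals
  into the complex numbers (\<open>sum_forgotten\<close>).

  For this argument \<open>\<omega>\<close> is needed over \<open>\<int>\<close> and over \<open>\<complex>\<close>, compatibly. Over any commutative ring the
  ring of symmetric functions is the polynomial ring in \<open>e\<^sub>1, e\<^sub>2, \<dots>\<close> (\<open>bij_e_eval\<close>), because a monomial in the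
  \<open>e\<^sub>i\<close> has a lexicographically leading term that determines it, and every
  monomial with weakly decreasing exponents occurs as such a leading term.
\<close>

section \<open>Evaluation of polynomials in countably many indeterminates\<close>

text \<open>
  Changes of coefficients, evaluations of polynomials and the involution are all ring homomorphisms
  between types; their shared laws are derived once here.
\<close>

locale ring_map =
  fixes f :: "'a::comm_ring_1 \<Rightarrow> 'b::comm_ring_1"
  assumes map_add: "f (x + y) = f x + f y"
    and map_mult: "f (x * y) = f x * f y"
    and map_1: "f 1 = 1"
begin

lemma map_0: "f 0 = 0"
  using map_add[of 0 0] by simp

lemma map_uminus: "f (- x) = - f x"
  using map_add[of x "- x"] by (simp add: map_0 eq_neg_iff_add_eq_0 add.commute)

lemma map_diff: "f (x - y) = f x - f y"
  using map_add[of x "- y"] by (simp add: map_uminus)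

lemma map_sum: "f (sum g A) = (\<Sum>x\<in>A. f (g x))"
  by (induction A rule: infinite_finite_induct) (auto simp: map_0 map_add)

lemma map_prod: "f (prod g A) = (\<Prod>x\<in>A. f (g x))"
  by (induction A rule: infinite_finite_induct) (auto simp: map_1 map_mult)

lemma map_prod_mset: "f (\<Prod>x\<in>#M. g x) = (\<Prod>x\<in>#M. f (g x))"
  by (induction M) (auto simp: map_1 map_mult)

lemma map_power: "f (x ^ n) = f x ^ n"
  by (induction n) (auto simp: map_1 map_mult)

lemma map_of_nat: "f (of_nat n) = of_nat n"
  by (induction n) (auto simp: map_0 map_1 map_add)

lemma map_of_int: "f (of_int n) = of_int n"
  by (cases n) (simp_all add: map_of_nat map_uminus map_diff map_1)

end

lemma ring_map_of_int: "ring_map (of_int :: int \<Rightarrow> 'a::comm_ring_1)"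
  by unfold_locales auto

definition mpow :: "(nat \<Rightarrow> 'b::comm_ring_1) \<Rightarrow> monom \<Rightarrow> 'b" where
  "mpow v a = (\<Prod>i\<in>Poly_Mapping.keys a. v i ^ Poly_Mapping.lookup a i)"

lemma mpow_superset:
  assumes "finite A" "Poly_Mapping.keys a \<subseteq> A"
  shows "mpow v a = (\<Prod>i\<in>A. v i ^ Poly_Mapping.lookup a i)"
  unfolding mpow_def using assms by (intro prod.mono_neutral_left) (auto simp: in_keys_iff)

lemma mpow_0: "mpow v 0 = 1"
  by (simp add: mpow_def)

lemma mpow_add: "mpow v (a + b) = mpow v a * mpow v b"
proof -
  let ?A = "Poly_Mapping.keys a \<union> Poly_Mapping.keys b"
  have "Poly_Mapping.keys (a + b) \<subseteq> ?A"
    by (rule Poly_Mapping.keys_add)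
  then show ?thesis
    by (simp add: mpow_superset[of ?A] lookup_add power_add prod.distrib)
qed

lemma mpow_single: "mpow v (Poly_Mapping.single i n) = v i ^ n"
  by (simp add: mpow_def)

definition meval :: "('a::comm_ring_1 \<Rightarrow> 'b::comm_ring_1) \<Rightarrow> (nat \<Rightarrow> 'b) \<Rightarrow> 'a mpoly \<Rightarrow> 'b" where
  "meval f v P = (\<Sum>a\<in>Poly_Mapping.keys P. f (Poly_Mapping.lookup P a) * mpow v a)"

context ring_map
begin

lemma meval_superset:
  assumes "finite A" "Poly_Mapping.keys P \<subseteq> A"
  shows "meval f v P = (\<Sum>a\<in>A. f (Poly_Mapping.lookup P a) * mpow v a)"
  unfolding meval_def using assms
  by (intro sum.mono_neutral_left) (auto simp: in_keys_iff map_0)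

lemma meval_single: "meval f v (Poly_Mapping.single a c) = f c * mpow v a"
  by (subst meval_superset[of "{a}"]) auto

lemma meval_add: "meval f v (P + Q) = meval f v P + meval f v Q"
proof -
  let ?A = "Poly_Mapping.keys P \<union> Poly_Mapping.keys Q"
  have "Poly_Mapping.keys (P + Q) \<subseteq> ?A"
    by (rule Poly_Mapping.keys_add)
  then show ?thesis
    by (simp add: meval_superset[of ?A] lookup_add map_add distrib_right sum.distrib)
qed

lemma meval_0: "meval f v 0 = 0"
  by (simp add: meval_def)

lemma meval_sum: "meval f v (sum g A) = (\<Sum>x\<in>A. meval f v (g x))"
  by (induction A rule: infinite_finite_induct) (auto simp: meval_0 meval_add)

end

lemma mpoly_sum_single:
  "P = (\<Sum>a\<in>Poly_Mapping.keys P. Poly_Mapping.single a (Poly_Mapping.lookup P a))"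
  by (rule poly_mapping_eqI)
    (auto simp: lookup_sum lookup_single when_def in_keys_iff)

context ring_map
begin

lemma meval_mult: "meval f v (P * Q) = meval f v P * meval f v Q"
proof -
  have "P * Q = (\<Sum>a\<in>Poly_Mapping.keys P. \<Sum>b\<in>Poly_Mapping.keys Q.
      Poly_Mapping.single (a + b) (Poly_Mapping.lookup P a * Poly_Mapping.lookup Q b))"
    by (subst (1) mpoly_sum_single[of P], subst (1) mpoly_sum_single[of Q])
      (simp add: sum_product mult_single)
  then have "meval f v (P * Q) = (\<Sum>a\<in>Poly_Mapping.keys P. \<Sum>b\<in>Poly_Mapping.keys Q.
      f (Poly_Mapping.lookup P a) * mpow v a * (f (Poly_Mapping.lookup Q b) * mpow v b))"
    by (simp add: meval_sum meval_single map_mult mpow_add mult_ac)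
  then show ?thesis
    by (simp add: meval_def sum_product)
qed

lemma meval_1: "meval f v 1 = 1"
  using meval_single[of v 0 1] by (simp add: map_1 mpow_0)

lemma ring_map_meval: "ring_map (meval f v)"
  by unfold_locales (auto simp: meval_add meval_mult meval_1)

lemma meval_mvar: "meval f v (mvar i) = v i"
  by (simp add: mvar_def meval_single mpow_single map_1)

end


section \<open>Leading monomials\<close>

lemma sf_coeff_add: "sf_coeff (F + G) p = sf_coeff F p + sf_coeff G p"
  by transfer simp

lemma sf_coeff_diff: "sf_coeff (F - G) p = sf_coeff F p - sf_coeff G p"
  by transfer simp

lemma sf_coeff_0: "sf_coeff 0 p = 0"
  by transfer simp

lemma sf_coeff_1: "sf_coeff 1 p = (if p = 0 then 1 else 0)"
  by transfer simp

lemma sf_coeff_mult: "sf_coeff (F * G) p = (\<Sum>(q, r) | q + r = p. sf_coeff F q * sf_coeff G r)"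
  by (simp add: times_symfun.rep_eq)

lemma sf_coeff_scale: "sf_coeff (sf_scale c F) p = c * sf_coeff F p"
  by transfer simp

lemma sf_coeff_sum: "sf_coeff (sum F A) p = (\<Sum>x\<in>A. sf_coeff (F x) p)"
  by (induction A rule: infinite_finite_induct) (auto simp: sf_coeff_0 sf_coeff_add)

lemma sf_coeff_mperm: "bij \<pi> \<Longrightarrow> sf_coeff F (mperm \<pi> p) = sf_coeff F p"
  by transfer simp

lemma sf_scale_mult_left: "sf_scale c F * G = sf_scale c (F * G)"
  by (rule sf_eqI) (simp add: sf_coeff_mult sf_coeff_scale sum_distrib_left case_prod_unfold mult.assoc)

lemma sf_scale_eq_mult: "sf_scale c 1 * F = sf_scale c F"
  by (simp add: sf_scale_mult_left)

lemma ring_map_scale: "ring_map (\<lambda>c. sf_scale c 1)"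
  by unfold_locales
    (auto intro!: sf_eqI simp: sf_scale_eq_mult sf_coeff_scale sf_coeff_add distrib_right)

interpretation scale: ring_map "\<lambda>c. sf_scale c 1"
  by (rule ring_map_scale)

lemma sf_degree_bound: "\<exists>d. \<forall>p. sf_coeff F p \<noteq> 0 \<longrightarrow> mdeg p \<le> d"
  by transfer blast

lemma sf_coeff_mult_nonzeroE:
  assumes "sf_coeff (F * G) p \<noteq> 0"
  obtains q r where "p = q + r" "sf_coeff F q \<noteq> 0" "sf_coeff G r \<noteq> 0"
proof -
  have "\<exists>x\<in>{(q, r). q + r = p}. (case x of (q, r) \<Rightarrow> sf_coeff F q * sf_coeff G r) \<noteq> 0"
  proof (rule ccontr)
    assume "\<not> ?thesis"
    then have "sf_coeff (F * G) p = 0"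
      unfolding sf_coeff_mult by (intro sum.neutral) blast
    with assms show False by simp
  qed
  then obtain q r where qr: "q + r = p" "sf_coeff F q * sf_coeff G r \<noteq> 0" by auto
  from qr(2) have "sf_coeff F q \<noteq> 0" "sf_coeff G r \<noteq> 0" by auto
  with qr(1) show thesis using that by blast
qed

lemma sf_homogeneous_mult:
  "sf_homogeneous k F \<Longrightarrow> sf_homogeneous l G \<Longrightarrow> sf_homogeneous (k + l) (F * G)"
  unfolding sf_homogeneous_def by (auto elim!: sf_coeff_mult_nonzeroE simp: mdeg_add)

lemma sf_homogeneous_1: "sf_homogeneous 0 1"
  by (auto simp: sf_homogeneous_def sf_coeff_1)

lemma sf_homogeneous_prod:
  "(\<And>i. i \<in> A \<Longrightarrow> sf_homogeneous (k i) (F i)) \<Longrightarrow> sf_homogeneous (sum k A) (prod F A)"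
  by (induction A rule: infinite_finite_induct) (auto simp: sf_homogeneous_1 sf_homogeneous_mult)

text \<open>
  The order on monomials is the lexicographic order of exponent vectors, with \<open>x\<^sub>1\<close> largest; it is
  compatible with multiplication, which is what makes leading monomials multiplicative. The
  condition asks for leading coefficient 1.
\<close>

definition sf_lead :: "'a::comm_ring_1 symfun \<Rightarrow> monom \<Rightarrow> bool" where
  "sf_lead F p \<longleftrightarrow> sf_coeff F p = 1 \<and> (\<forall>q. sf_coeff F q \<noteq> 0 \<longrightarrow> q \<le> p)"

lemma sf_lead_1: "sf_lead 1 0"
  by (auto simp: sf_lead_def sf_coeff_1)

text \<open>
  If \<open>q + r = p + p'\<close> with \<open>q \<le> p\<close> and \<open>r \<le> p'\<close>, then both inequalities are equalities, so only one
  term contributes to the coefficient at \<open>p + p'\<close>.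
\<close>

lemma sf_lead_mult:
  assumes F: "sf_lead F p" and G: "sf_lead G p'"
  shows "sf_lead (F * G) (p + p')"
proof -
  have "sf_coeff F q * sf_coeff G r = 0" if "q + r = p + p'" "(q, r) \<noteq> (p, p')" for q r
  proof (rule ccontr)
    assume "\<not> ?thesis"
    then have "sf_coeff F q \<noteq> 0" "sf_coeff G r \<noteq> 0" by auto
    with F G have "q \<le> p" "r \<le> p'" by (simp_all add: sf_lead_def)
    have "p + p' \<le> p + r" "p + p' \<le> q + p'"
      using that(1) add_right_mono[OF \<open>q \<le> p\<close>, of r] add_left_mono[OF \<open>r \<le> p'\<close>, of q] by simp_all
    then have "p' \<le> r" "p \<le> q"
      by (simp_all only: add_le_cancel_left add_le_cancel_right)
    with \<open>q \<le> p\<close> \<open>r \<le> p'\<close> have "q = p \<and> r = p'" by simp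
    with that(2) show False by simp
  qed
  then have "sf_coeff (F * G) (p + p') = (\<Sum>(q, r)\<in>{(p, p')}. sf_coeff F q * sf_coeff G r)"
    unfolding sf_coeff_mult
    by (intro sum.mono_neutral_right finite_monom_splits) auto
  also have "\<dots> = 1" using F G by (simp add: sf_lead_def)
  finally have "sf_coeff (F * G) (p + p') = 1" .
  moreover have "q \<le> p + p'" if "sf_coeff (F * G) q \<noteq> 0" for q
    using that F G by (auto elim!: sf_coeff_mult_nonzeroE simp: sf_lead_def intro: add_mono)
  ultimately show ?thesis by (auto simp: sf_lead_def)
qed

lemma sf_lead_prod:
  "(\<And>i. i \<in> A \<Longrightarrow> sf_lead (F i) (p i)) \<Longrightarrow> sf_lead (prod F A) (sum p A)"
  by (induction A rule: infinite_finite_induct) (auto simp: sf_lead_1 sf_lead_mult)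

definition block :: "nat \<Rightarrow> monom" where
  "block k = (\<Sum>i<k. Poly_Mapping.single i 1)"

lemma lookup_block: "Poly_Mapping.lookup (block k) j = (if j < k then 1 else 0)"
  by (auto simp: block_def lookup_sum lookup_single when_def)

lemma keys_block: "Poly_Mapping.keys (block k) = {..<k}"
  by (auto simp: in_keys_iff lookup_block split: if_splits)

lemma mdeg_block: "mdeg (block k) = k"
  by (simp add: mdeg_def keys_block lookup_block)

lemma sf_coeff_e:
  "sf_coeff (sf_e k) p = (if mdeg p = k \<and> (\<forall>i. Poly_Mapping.lookup p i \<le> 1) then 1 else 0)"
  by transfer simp

lemma sf_coeff_h: "sf_coeff (sf_h k) p = (if mdeg p = k then 1 else 0)"
  by transfer simp

text \<open>
  A larger squarefree monomial would contain \<open>x\<^sub>1 \<cdots> x\<^sub>k\<close> and one further variable, so its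
  degree would exceed \<open>k\<close>.
\<close>

lemma sf_lead_e: "sf_lead (sf_e k) (block k)"
proof -
  have "q \<le> block k" if deg: "mdeg q = k" and le: "\<And>i. Poly_Mapping.lookup q i \<le> 1" for q
  proof (rule ccontr)
    assume "\<not> q \<le> block k"
    then have "block k < q" by simp
    then obtain i where i: "Poly_Mapping.lookup (block k) i < Poly_Mapping.lookup q i"
      and below: "\<And>j. j < i \<Longrightarrow> Poly_Mapping.lookup (block k) j = Poly_Mapping.lookup q j"
      by (auto simp: less_poly_mapping.rep_eq less_fun_def)
    have "k \<le> i" using i le[of i] by (auto simp: lookup_block split: if_splits)
    moreover have "j \<in> Poly_Mapping.keys q" if "j \<le> i" "j < k \<or> j = i" for j
      using that below[of j] i \<open>k \<le> i\<close> by (cases "j = i") (auto simp: in_keys_iff lookup_block)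
    ultimately have "insert i {..<k} \<subseteq> Poly_Mapping.keys q" by auto
    then have "card (insert i {..<k}) \<le> card (Poly_Mapping.keys q)"
      by (intro card_mono) auto
    also have "\<dots> = (\<Sum>j\<in>Poly_Mapping.keys q. 1)" by simp
    also have "\<dots> \<le> mdeg q"
      unfolding mdeg_def by (intro sum_mono) (metis in_keys_iff less_one not_le)
    finally show False using deg \<open>k \<le> i\<close> by simp
  qed
  then show ?thesis
    by (auto simp: sf_lead_def sf_coeff_e mdeg_block lookup_block)
qed

lemma sf_homogeneous_e: "sf_homogeneous k (sf_e k)"
  by (simp add: sf_homogeneous_def sf_coeff_e)

definition e_lead :: "monom \<Rightarrow> monom" where
  "e_lead a = (\<Sum>i\<in>Poly_Mapping.keys a. \<Sum>_<Poly_Mapping.lookup a i. block (Suc i))"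

abbreviation e_pow :: "monom \<Rightarrow> 'a::comm_ring_1 symfun" where
  "e_pow \<equiv> mpow (\<lambda>i. sf_e (Suc i))"

lemma e_pow_altdef:
  "e_pow a = (\<Prod>i\<in>Poly_Mapping.keys a. \<Prod>_<Poly_Mapping.lookup a i. sf_e (Suc i))"
  by (simp add: mpow_def)

lemma sf_lead_e_pow: "sf_lead (e_pow a) (e_lead a)"
  unfolding e_pow_altdef e_lead_def by (intro sf_lead_prod sf_lead_e)

text \<open>
  The product is homogeneous of some degree, and its leading monomial, having coefficient 1, shows
  which degree it is.
\<close>

lemma sf_homogeneous_e_pow: "sf_homogeneous (mdeg (e_lead a)) (e_pow a :: 'a::comm_ring_1 symfun)"
proof -
  let ?d = "\<Sum>i\<in>Poly_Mapping.keys a. \<Sum>_<Poly_Mapping.lookup a i. Suc i"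
  have hom: "sf_homogeneous ?d (e_pow a :: 'a symfun)"
    unfolding e_pow_altdef by (intro sf_homogeneous_prod sf_homogeneous_e)
  moreover have "sf_coeff (e_pow a :: 'a symfun) (e_lead a) = 1"
    using sf_lead_e_pow[of a, where 'a='a] by (simp add: sf_lead_def)
  ultimately have "mdeg (e_lead a) = ?d" 
    unfolding sf_homogeneous_def by (metis zero_neq_one)
  with hom show ?thesis by simp
qed

lemma lookup_e_lead:
  "Poly_Mapping.lookup (e_lead a) j
    = (\<Sum>i\<in>Poly_Mapping.keys a. if j \<le> i then Poly_Mapping.lookup a i else 0)"
  unfolding e_lead_def lookup_sum lookup_block by (intro sum.cong) auto

text \<open>
  The exponents of \<open>a\<close> are the successive differences of the exponents of its leading monomial. So
  the leading monomial determines \<open>a\<close>, and every weakly decreasing exponent vector is a leading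
  monomial.
\<close>

lemma lookup_e_lead_rec:
  "Poly_Mapping.lookup (e_lead a) j
    = Poly_Mapping.lookup a j + Poly_Mapping.lookup (e_lead a) (Suc j)"
proof -
  have "Poly_Mapping.lookup (e_lead a) j = (\<Sum>i\<in>Poly_Mapping.keys a.
      (if i = j then Poly_Mapping.lookup a i else 0)
      + (if Suc j \<le> i then Poly_Mapping.lookup a i else 0))"
    unfolding lookup_e_lead by (intro sum.cong) auto
  also have "\<dots> = Poly_Mapping.lookup a j + Poly_Mapping.lookup (e_lead a) (Suc j)"
    by (auto simp: sum.distrib lookup_e_lead in_keys_iff)
  finally show ?thesis .
qed

lemma inj_e_lead: "inj e_lead"
proof (rule injI, rule poly_mapping_eqI)
  fix a b j assume "e_lead a = e_lead b"
  then show "Poly_Mapping.lookup a j = Poly_Mapping.lookup b j"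
    using lookup_e_lead_rec[of a j] lookup_e_lead_rec[of b j] by simp
qed

definition antitone :: "monom \<Rightarrow> bool" where
  "antitone p \<longleftrightarrow> (\<forall>i j. i \<le> j \<longrightarrow> Poly_Mapping.lookup p j \<le> Poly_Mapping.lookup p i)"

lemma antitone_eq_e_lead:
  assumes "antitone p"
  obtains a where "p = e_lead a"
proof -
  obtain N where N: "Poly_Mapping.keys p \<subseteq> {..<N}"
    using finite_nat_set_iff_bounded[of "Poly_Mapping.keys p"] by auto
  then have p0: "Poly_Mapping.lookup p i = 0" if "i \<ge> N" for i
    using that by (metis in_keys_iff lessThan_iff not_le subsetD)
  have "finite {i. Poly_Mapping.lookup p i - Poly_Mapping.lookup p (Suc i) \<noteq> 0}"
    by (rule finite_subset[of _ "{..<N}"]) (use p0 in \<open>auto simp: not_le[symmetric]\<close>)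
  then have a: "Poly_Mapping.lookup (Abs_poly_mapping (\<lambda>i. Poly_Mapping.lookup p i
      - Poly_Mapping.lookup p (Suc i))) i
      = Poly_Mapping.lookup p i - Poly_Mapping.lookup p (Suc i)" (is "Poly_Mapping.lookup ?a i = _") for i
    by (simp add: lookup_Abs_poly_mapping)
  have "Poly_Mapping.lookup (e_lead ?a) j = Poly_Mapping.lookup p j" if "j \<le> N" for j
    using that
  proof (induction rule: inc_induct)
    case base
    show ?case using p0 by (auto simp: lookup_e_lead a intro!: sum.neutral)
  next
    case (step n)
    have "Poly_Mapping.lookup p (Suc n) \<le> Poly_Mapping.lookup p n"
      using assms by (simp add: antitone_def)
    then show ?case using step.IH by (subst lookup_e_lead_rec) (simp add: a)
  qed
  moreover have "Poly_Mapping.lookup (e_lead ?a) j = Poly_Mapping.lookup p j" if "j \<ge> N" for j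
    using that p0 by (auto simp: lookup_e_lead a intro!: sum.neutral)
  ultimately have "p = e_lead ?a"
    by (intro poly_mapping_eqI) (metis nat_le_linear)
  then show thesis by (rule that)
qed

lemma antitone_keys: 
  assumes "antitone p" 
  shows "Poly_Mapping.keys p \<subseteq> {..<mdeg p}"
proof
  fix i assume i: "i \<in> Poly_Mapping.keys p"
  have "Poly_Mapping.lookup p j \<ge> 1" if "j \<le> i" for j
    using assms i that by (metis One_nat_def antitone_def in_keys_iff le_trans less_one not_le)
  then have "(\<Sum>j\<in>{..i}. 1) \<le> (\<Sum>j\<in>{..i}. Poly_Mapping.lookup p j)"
    by (intro sum_mono) auto
  also have "\<dots> \<le> (\<Sum>j\<in>Poly_Mapping.keys p \<union> {..i}. Poly_Mapping.lookup p j)"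
    by (intro sum_mono2) auto
  also have "\<dots> = mdeg p"
    by (rule mdeg_superset[symmetric]) auto
  finally show "i \<in> {..<mdeg p}" by simp
qed

text \<open>
  Among the finitely many rearrangements of \<open>p\<close> on an initial segment of the variables, the
  lexicographically largest one is weakly decreasing, since exchanging two exponents that increase
  would make it larger.
\<close>

lemma mperm_antitone:
  obtains \<pi> where "bij \<pi>" "antitone (mperm \<pi> p)"
proof -
  obtain N where N: "Poly_Mapping.keys p \<subseteq> {..<N}"
    using finite_nat_set_iff_bounded[of "Poly_Mapping.keys p"] by auto
  \<comment> \<open>the rearrangements of \<open>p\<close> on the variables with index below \<open>N\<close>\<close>
  define S where "S = {q. \<exists>\<pi>. bij \<pi> \<and> q = mperm \<pi> p \<and> Poly_Mapping.keys q \<subseteq> {..<N}}"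
  have "S \<subseteq> {q. Poly_Mapping.keys q \<subseteq> {..<N} \<and> mdeg q \<le> mdeg p}"
    by (auto simp: S_def mdeg_mperm)
  then have fin: "finite S" by (rule finite_subset) (simp add: finite_bounded_monoms)
  have "mperm id p = p" by (rule poly_mapping_eqI) (simp add: lookup_mperm)
  then have "p \<in> S" using N by (auto simp: S_def intro!: exI[of _ id])
  then have "S \<noteq> {}" by auto
  define q where "q = Max S"
  have q: "q \<in> S" and max: "\<And>r. r \<in> S \<Longrightarrow> r \<le> q"
    using fin \<open>S \<noteq> {}\<close> by (auto simp: q_def)
  then obtain \<pi> where \<pi>: "bij \<pi>" "q = mperm \<pi> p" and keys: "Poly_Mapping.keys q \<subseteq> {..<N}"
    by (auto simp: S_def)
  have "antitone q"
  proof (rule ccontr)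
    assume "\<not> antitone q"
    then obtain i j where ij: "i \<le> j" "Poly_Mapping.lookup q i < Poly_Mapping.lookup q j"
      by (auto simp: antitone_def not_le)
    then have "i < j" by (metis le_neq_implies_less less_irrefl)
    have "j < N" using ij keys by (metis in_keys_iff lessThan_iff not_less0 subsetD)
    define \<tau> where "\<tau> = Transposition.transpose i j"
    have \<tau>: "bij \<tau>" by (simp add: \<tau>_def)
    have eq: "mperm \<tau> q = mperm (\<pi> \<circ> \<tau>) p"
      using \<pi> \<tau> by (auto intro!: poly_mapping_eqI simp: lookup_mperm bij_comp)
    have "Poly_Mapping.keys (mperm \<tau> q) \<subseteq> {..<N}"
    proof
      fix x assume "x \<in> Poly_Mapping.keys (mperm \<tau> q)"
      then have "\<tau> x < N" using keys by (auto simp: keys_mperm \<tau>)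
      then show "x \<in> {..<N}" using \<open>i < j\<close> \<open>j < N\<close>
        by (auto simp: \<tau>_def Transposition.transpose_def split: if_splits)
    qed
    then have "mperm \<tau> q \<in> S" using \<pi> \<tau> eq by (auto simp: S_def intro!: exI[of _ "\<pi> \<circ> \<tau>"] bij_comp)
    then have "mperm \<tau> q \<le> q" by (rule max)
    moreover have "q < mperm \<tau> q"
      unfolding less_poly_mapping.rep_eq less_fun_def lookup_mperm[OF \<tau>] using ij \<open>i < j\<close>
      by (intro exI[of _ i]) (auto simp: \<tau>_def Transposition.transpose_def)
    ultimately show False by simp
  qed
  then show thesis using that \<pi> by auto
qed

lemma sf_eqI_antitone:
  assumes "\<And>p. antitone p \<Longrightarrow> sf_coeff F p = sf_coeff G p"
  shows "F = G"
proof (rule sf_eqI)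
  fix p
  obtain \<pi> where "bij \<pi>" "antitone (mperm \<pi> p)" by (rule mperm_antitone)
  then show "sf_coeff F p = sf_coeff G p" using assms[of "mperm \<pi> p"] by (simp add: sf_coeff_mperm)
qed


section \<open>The fundamental theorem of symmetric functions\<close>

definition e_eval :: "'a::comm_ring_1 mpoly \<Rightarrow> 'a symfun" where
  "e_eval = meval (\<lambda>c. sf_scale c 1) (\<lambda>i. sf_e (Suc i))"

lemma e_eval_altdef:
  "e_eval P = (\<Sum>a\<in>Poly_Mapping.keys P. sf_scale (Poly_Mapping.lookup P a) (e_pow a))"
  by (simp add: e_eval_def meval_def sf_scale_eq_mult)

interpretation e_eval: ring_map e_eval
  unfolding e_eval_def by (rule scale.ring_map_meval)

text \<open>
  Algebraic independence of the elementary symmetric functions: distinct monomials in them have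
  distinct leading monomials, so the largest of these cannot cancel.
\<close>

lemma e_eval_eq_0:
  assumes "e_eval P = 0"
  shows "P = 0"
proof (rule ccontr)
  assume "P \<noteq> 0"
  then have ne: "e_lead ` Poly_Mapping.keys P \<noteq> {}" by simp
  then obtain a where a: "a \<in> Poly_Mapping.keys P" "e_lead a = Max (e_lead ` Poly_Mapping.keys P)"
    by (metis Max_in finite_imageI finite_keys imageE)
  have "sf_coeff (e_pow b) (e_lead a) = (0 :: 'a)" if "b \<in> Poly_Mapping.keys P" "b \<noteq> a" for b
  proof (rule ccontr)
    assume "\<not> ?thesis"
    then have "e_lead a \<le> e_lead b" using sf_lead_e_pow[of b] by (auto simp: sf_lead_def)
    moreover have "e_lead b \<le> e_lead a" using a that by auto
    ultimately show False using that inj_e_lead by (auto dest: injD)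
  qed
  then have "sf_coeff (e_eval P) (e_lead a) = (\<Sum>b\<in>{a}. sf_coeff (sf_scale (Poly_Mapping.lookup P b) (e_pow b)) (e_lead a))"
    unfolding e_eval_altdef sf_coeff_sum using a(1)
    by (intro sum.mono_neutral_right) (auto simp: sf_coeff_scale)
  also have "\<dots> = Poly_Mapping.lookup P a"
    using sf_lead_e_pow[of a, where 'a='a] by (simp add: sf_coeff_scale sf_lead_def)
  finally show False using assms a by (simp add: sf_coeff_0 in_keys_iff)
qed

text \<open>
  Subtracting a multiple of the product of elementary symmetric functions with the same leading
  monomial removes the largest weakly decreasing monomial of \<open>F\<close> and affects otherwise only smaller
  ones. There are finitely many weakly decreasing monomials of bounded degree, so this ends.
\<close>

lemma e_eval_surj:
  fixes F :: "'a::comm_ring_1 symfun"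
  obtains P where "e_eval P = F"
proof -
  obtain d where d: "\<And>p. sf_coeff F p \<noteq> 0 \<Longrightarrow> mdeg p \<le> d"
    using sf_degree_bound by blast
  define A where "A = {p. antitone p \<and> mdeg p \<le> d}"
  have "A \<subseteq> {p. Poly_Mapping.keys p \<subseteq> {..<d} \<and> mdeg p \<le> d}"
    by (auto simp: A_def dest!: antitone_keys)
  then have fin: "finite A"
    by (rule finite_subset) (simp add: finite_bounded_monoms)
  \<comment> \<open>the number of elimination steps that can still be needed below \<open>p\<close>\<close>
  define rank where "rank p = card {q \<in> A. q < p}" for p
  have rank_mono: "rank p < rank q" if "p < q" "p \<in> A" for p q
    unfolding rank_def using that fin by (intro psubset_card_mono) (auto)
  have "\<exists>P. e_eval P = F"
    if "\<And>p. sf_coeff F p \<noteq> 0 \<Longrightarrow> mdeg p \<le> d"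
      "\<And>p. p \<in> A \<Longrightarrow> sf_coeff F p \<noteq> 0 \<Longrightarrow> rank p < n" for n and F :: "'a symfun"
    using that
  proof (induction n arbitrary: F)
    case 0
    then have "F = 0" by (intro sf_eqI_antitone) (auto simp: sf_coeff_0 A_def)
    then have "e_eval 0 = F" by (simp add: e_eval.map_0)
    then show ?case ..
  next
    case (Suc n)
    show ?case
    proof (cases "\<exists>p\<in>A. sf_coeff F p \<noteq> 0 \<and> rank p = n")
      case False
      then show ?thesis using Suc.prems by (intro Suc.IH) (auto simp: less_Suc_eq)
    next
      case True
      then obtain p where p: "p \<in> A" "sf_coeff F p \<noteq> 0" "rank p = n" by auto
      then obtain a where a: "p = e_lead a" using antitone_eq_e_lead by (auto simp: A_def)
      \<comment> \<open>the elimination step; every weakly decreasing monomial of \<open>G\<close> lies below \<open>p\<close>\<close>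
      define G where "G = F - sf_scale (sf_coeff F p) (e_pow a)"
      have lead: "sf_lead (e_pow a :: 'a symfun) p" using a sf_lead_e_pow by auto
      have hom: "sf_homogeneous (mdeg p) (e_pow a :: 'a symfun)" using a sf_homogeneous_e_pow by auto
      have "\<exists>P. e_eval P = G"
      proof (rule Suc.IH)
        fix q assume "sf_coeff G q \<noteq> 0"
        then have "sf_coeff F q \<noteq> 0 \<or> sf_coeff (e_pow a :: 'a symfun) q \<noteq> 0"
          by (auto simp: G_def sf_coeff_diff sf_coeff_scale)
        then show "mdeg q \<le> d" using hom p Suc.prems(1) by (auto simp: A_def sf_homogeneous_def)
      next
        fix q assume q: "q \<in> A" "sf_coeff G q \<noteq> 0"
        have "q \<noteq> p"
          using q lead by (auto simp: G_def sf_coeff_diff sf_coeff_scale sf_lead_def)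
        moreover have "\<not> p < q"
        proof
          assume "p < q"
          then have "sf_coeff (e_pow a :: 'a symfun) q = 0" using lead by (auto simp: sf_lead_def)
          then have "sf_coeff F q \<noteq> 0" using q by (auto simp: G_def sf_coeff_diff sf_coeff_scale)
          then have "rank q < Suc n" using q Suc.prems by auto
          with rank_mono[OF \<open>p < q\<close> p(1)] p(3) show False by simp
        qed
        ultimately have "q < p" by simp
        then show "rank q < n" using rank_mono q p by auto
      qed
      then obtain P where "e_eval P = G" ..
      then have "e_eval (P + Poly_Mapping.single a (sf_coeff F p)) = F"
        by (simp add: e_eval.map_add) (simp add: G_def e_eval_def scale.meval_single sf_scale_eq_mult)
      then show ?thesis ..
    qed
  qed
  moreover have "rank p < Suc (card A)" for p
    unfolding rank_def by (intro le_imp_less_Suc card_mono fin) auto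
  ultimately have "\<exists>P. e_eval P = F" using d by blast
  then show thesis using that by blast
qed

lemma bij_e_eval: "bij (e_eval :: 'a::comm_ring_1 mpoly \<Rightarrow> _)"
proof (rule bijI)
  show "inj (e_eval :: 'a mpoly \<Rightarrow> _)"
  proof (rule injI)
    fix P Q :: "'a mpoly" assume "e_eval P = e_eval Q"
    then have "e_eval (P - Q) = 0" by (simp add: e_eval.map_diff)
    then show "P = Q" using e_eval_eq_0[of "P - Q"] by simp
  qed
  show "surj (e_eval :: 'a mpoly \<Rightarrow> _)" unfolding surj_def by (metis e_eval_surj)
qed


section \<open>The involution\<close>

lemma ring_map_comp:
  assumes "ring_map f" "ring_map g"
  shows "ring_map (\<lambda>x. f (g x))"
proof -
  interpret f: ring_map f by fact
  interpret g: ring_map g by fact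
  show ?thesis
    by unfold_locales (simp_all add: f.map_add g.map_add f.map_mult g.map_mult f.map_1 g.map_1)
qed

lemma ring_map_inv:
  assumes "ring_map f" "bij f"
  shows "ring_map (inv f)"
proof -
  interpret ring_map f by fact
  have inv: "inv f y = x" if "f x = y" for x y
    using that assms(2) by (auto simp: bij_is_inj)
  have f_inv: "f (inv f y) = y" for y
    using assms(2) by (simp add: bij_is_surj surj_f_inv_f)
  show ?thesis
    by unfold_locales (rule inv; simp add: map_add map_mult map_1 f_inv)+
qed

definition h_eval :: "'a::comm_ring_1 mpoly \<Rightarrow> 'a symfun" where
  "h_eval = meval (\<lambda>c. sf_scale c 1) (\<lambda>i. sf_h (Suc i))"

text \<open>
  The involution over an arbitrary coefficient ring: express a symmetric function as a polynomial
  in the \<open>e\<^sub>k\<close> and evaluate that polynomial at the \<open>h\<^sub>k\<close>.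
\<close>

definition omega_gen :: "'a::comm_ring_1 symfun \<Rightarrow> 'a symfun" where
  "omega_gen F = h_eval (inv e_eval F)"

interpretation omega_gen: ring_map omega_gen
  unfolding omega_gen_def h_eval_def
  by (rule ring_map_comp[OF scale.ring_map_meval ring_map_inv[OF e_eval.ring_map_axioms bij_e_eval]])

lemma omega_gen_e_eval: "omega_gen (e_eval P) = h_eval P"
  by (simp add: omega_gen_def bij_is_inj[OF bij_e_eval])

lemma mdeg_eq_0_iff: "mdeg p = 0 \<longleftrightarrow> p = 0"
proof
  assume "mdeg p = 0"
  then have "Poly_Mapping.lookup p i = 0" for i using lookup_le_mdeg[of p i] by simp
  then show "p = 0" by (intro poly_mapping_eqI) simp
qed simp

lemma sf_e_0: "sf_e 0 = 1"
  by (rule sf_eqI) (auto simp: sf_coeff_e sf_coeff_1 mdeg_eq_0_iff)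

lemma sf_h_0: "sf_h 0 = 1"
  by (rule sf_eqI) (auto simp: sf_coeff_h sf_coeff_1 mdeg_eq_0_iff)

lemma omega_gen_e: "omega_gen (sf_e k) = (sf_h k :: 'a::comm_ring_1 symfun)"
proof (cases k)
  case 0
  then show ?thesis by (simp add: sf_e_0 sf_h_0 omega_gen.map_1)
next
  case (Suc i)
  have "sf_e (Suc i) = (e_eval (mvar i) :: 'a symfun)"
    by (simp add: e_eval_def scale.meval_mvar)
  then show ?thesis
    using Suc by (simp add: omega_gen_e_eval) (simp add: h_eval_def scale.meval_mvar)
qed

lemma omega_gen_scale: "omega_gen (sf_scale c F) = sf_scale c (omega_gen F)"
proof -
  have "omega_gen (sf_scale c 1) = omega_gen (e_eval (Poly_Mapping.single 0 c))"
    by (simp add: e_eval_def scale.meval_single mpow_0)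
  also have "\<dots> = sf_scale c 1"
    by (simp only: omega_gen_e_eval) (simp add: h_eval_def scale.meval_single mpow_0)
  finally show ?thesis
    by (metis omega_gen.map_mult sf_scale_eq_mult)
qed

lemma sf_scale_int: "sf_scale c F = of_int c * F"
  using scale.map_of_int[of c, where 'a=int] sf_scale_eq_mult[of c F] by simp

text \<open>
  Over the integers no linearity has to be assumed, because additive maps commute with
  multiplication by integers; the \<open>e\<^sub>k\<close> then generate everything.
\<close>

lemma ring_map_symfun_unique:
  fixes w w' :: "int symfun \<Rightarrow> 'b::comm_ring_1"
  assumes "ring_map w" "ring_map w'" "\<And>k. w (sf_e k) = w' (sf_e k)"
  shows "w F = w' F"
proof -
  interpret w: ring_map w by fact
  interpret w': ring_map w' by fact
  obtain P where "F = e_eval P" by (metis e_eval_surj)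
  from \<open>F = e_eval P\<close> have F: "F = (\<Sum>a\<in>Poly_Mapping.keys P. of_int (Poly_Mapping.lookup P a) *
      (\<Prod>i\<in>Poly_Mapping.keys a. sf_e (Suc i) ^ Poly_Mapping.lookup a i))"
    by (simp add: e_eval_altdef mpow_def sf_scale_int)
  show ?thesis
    unfolding F by (simp add: w.map_sum w'.map_sum w.map_mult w'.map_mult w.map_of_int w'.map_of_int
        w.map_prod w'.map_prod w.map_power w'.map_power assms(3))
qed

lemma omega_eq: "omega = omega_gen"
  unfolding omega_def
proof (rule the_equality)
  show "omega_gen 1 = 1 \<and> (\<forall>F G :: int symfun. omega_gen (F + G) = omega_gen F + omega_gen G)
      \<and> (\<forall>F G :: int symfun. omega_gen (F * G) = omega_gen F * omega_gen G)
      \<and> (\<forall>k. omega_gen (sf_e k) = (sf_h k :: int symfun))"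
    by (simp add: omega_gen.map_1 omega_gen.map_add omega_gen.map_mult omega_gen_e)
next
  fix w :: "int symfun \<Rightarrow> int symfun"
  assume w: "w 1 = 1 \<and> (\<forall>F G. w (F + G) = w F + w G) \<and> (\<forall>F G. w (F * G) = w F * w G)
      \<and> (\<forall>k. w (sf_e k) = sf_h k)"
  then have "ring_map w" by unfold_locales auto
  show "w = omega_gen"
  proof
    fix F show "w F = omega_gen F"
      using \<open>ring_map w\<close> omega_gen.ring_map_axioms
      by (rule ring_map_symfun_unique) (use w in \<open>simp add: omega_gen_e\<close>)
  qed
qed

lift_definition sf_of_int :: "int symfun \<Rightarrow> 'a::comm_ring_1 symfun" is "\<lambda>F p. of_int (F p)"
  by (metis of_int_0)

lemma sf_coeff_of_int: "sf_coeff (sf_of_int F) p = of_int (sf_coeff F p)"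
  by transfer simp

lemma ring_map_sf_of_int: "ring_map sf_of_int"
  by unfold_locales
    (auto intro!: sf_eqI simp: sf_coeff_of_int sf_coeff_add sf_coeff_mult sf_coeff_1 case_prod_unfold)

lemma sf_of_int_e: "sf_of_int (sf_e k) = sf_e k"
  by (rule sf_eqI) (simp add: sf_coeff_of_int sf_coeff_e)

lemma sf_of_int_h: "sf_of_int (sf_h k) = sf_h k"
  by (rule sf_eqI) (simp add: sf_coeff_of_int sf_coeff_h)

lemma sf_coeff_m: "sf_coeff (sf_m \<nu>) p = (if mshape p = \<nu> then 1 else 0)"
  by transfer simp

lemma sf_of_int_m: "sf_of_int (sf_m \<nu>) = sf_m \<nu>"
  by (rule sf_eqI) (simp add: sf_coeff_of_int sf_coeff_m)

text \<open>
  Base change of the coefficients commutes with the involution, since both composites are ring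
  homomorphisms that send \<open>e\<^sub>k\<close> to \<open>h\<^sub>k\<close>.
\<close>

lemma sf_of_int_omega: "sf_of_int (omega F) = omega_gen (sf_of_int F)"
  unfolding omega_eq
  by (rule ring_map_symfun_unique[where w = "\<lambda>F. sf_of_int (omega_gen F)"
        and w' = "\<lambda>F. omega_gen (sf_of_int F)"])
    (auto intro: ring_map_comp ring_map_sf_of_int omega_gen.ring_map_axioms
      simp: omega_gen_e sf_of_int_e sf_of_int_h)


section \<open>Multiplicative sequences\<close>

definition fps_map :: "('a::comm_ring_1 \<Rightarrow> 'b::comm_ring_1) \<Rightarrow> 'a fps \<Rightarrow> 'b fps" where
  "fps_map f A = Abs_fps (\<lambda>n. f (fps_nth A n))"

lemma fps_map_nth [simp]: "fps_nth (fps_map f A) = (\<lambda>n. f (fps_nth A n))"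
  by (simp add: fps_map_def fun_eq_iff)

context ring_map
begin

lemma ring_map_fps_map: "ring_map (fps_map f)"
  by unfold_locales (auto simp: fps_eq_iff map_add map_mult map_sum map_1 map_0 fps_mult_nth)

lemma fps_map_compose_uminus_X: "fps_map f (A oo (- fps_X)) = fps_map f A oo (- fps_X)"
  by (simp add: fps_compose_uminus' fps_eq_iff map_mult map_power map_uminus map_1)

end

text \<open>
  The coefficient of the monomial \<open>p\<close> in the infinite product \<open>\<phi>(x\<^sub>1) \<phi>(x\<^sub>2) \<cdots>\<close>, when \<open>\<phi>\<close> has constant
  term 1.
\<close>

definition monom_coeff :: "'a::comm_ring_1 fps \<Rightarrow> monom \<Rightarrow> 'a" where
  "monom_coeff \<phi> p = (\<Prod>i\<in>#mshape p. fps_nth \<phi> i)"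

lemma monom_coeff_altdef:
  "monom_coeff \<phi> p = (\<Prod>i\<in>Poly_Mapping.keys p. fps_nth \<phi> (Poly_Mapping.lookup p i))"
  by (simp add: monom_coeff_def mshape_def image_mset.compositionality comp_def prod_unfold_prod_mset)

lemma monom_coeff_superset:
  assumes "fps_nth \<phi> 0 = 1" "finite A" "Poly_Mapping.keys p \<subseteq> A"
  shows "monom_coeff \<phi> p = (\<Prod>i\<in>A. fps_nth \<phi> (Poly_Mapping.lookup p i))"
  unfolding monom_coeff_altdef using assms
  by (intro prod.mono_neutral_left) (auto simp: in_keys_iff)

lift_definition mult_seq :: "'a::comm_ring_1 fps \<Rightarrow> nat \<Rightarrow> 'a symfun" is
  "\<lambda>\<phi> k p. if mdeg p = k then monom_coeff \<phi> p else 0"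
  by (auto simp: mdeg_mperm mshape_mperm monom_coeff_def)

lemma sf_coeff_mult_seq:
  "sf_coeff (mult_seq \<phi> k) p = (if mdeg p = k then monom_coeff \<phi> p else 0)"
  by (simp add: mult_seq.rep_eq)

text \<open>
  The exponents of a monomial of degree \<open>k\<close> are at most \<open>k\<close>. This allows a power series to be
  replaced by a polynomial.
\<close>

lemma mult_seq_cong:
  assumes "\<And>n. n \<le> k \<Longrightarrow> fps_nth \<phi> n = fps_nth \<psi> n"
  shows "mult_seq \<phi> k = mult_seq \<psi> k"
proof (rule sf_eqI)
  fix p :: monom
  show "sf_coeff (mult_seq \<phi> k) p = sf_coeff (mult_seq \<psi> k) p"
    using assms lookup_le_mdeg[of p]
    by (auto simp: sf_coeff_mult_seq monom_coeff_altdef intro!: prod.cong)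
qed

text \<open>
  Expanding the product over the variables of the convolution sums amounts to choosing, for every
  variable of \<open>p\<close>, how its exponent is divided between the two factors, which is a factorisation
  \<open>p = q + r\<close>.
\<close>

lemma monom_coeff_mult:
  assumes "fps_nth \<phi> 0 = 1" "fps_nth \<psi> 0 = 1"
  shows "monom_coeff (\<phi> * \<psi>) p = (\<Sum>(q, r) | q + r = p. monom_coeff \<phi> q * monom_coeff \<psi> r)"
proof -
  let ?K = "Poly_Mapping.keys p" and ?l = "Poly_Mapping.lookup"
  \<comment> \<open>the factor \<open>q\<close> that receives the exponent \<open>g i\<close> of each variable of \<open>p\<close>\<close>
  define Q where "Q g = Abs_poly_mapping (\<lambda>i. if i \<in> ?K then g i else 0)" for g :: "nat \<Rightarrow> nat"
  have Q: "?l (Q g) i = (if i \<in> ?K then g i else 0)" for g i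
    unfolding Q_def by (simp add: lookup_Abs_poly_mapping)
  let ?G = "PiE ?K (\<lambda>i. {0..?l p i})"
  have "monom_coeff (\<phi> * \<psi>) p
      = (\<Prod>i\<in>?K. \<Sum>j\<in>{0..?l p i}. fps_nth \<phi> j * fps_nth \<psi> (?l p i - j))"
    by (simp add: monom_coeff_altdef fps_mult_nth)
  also have "\<dots> = (\<Sum>g\<in>?G. \<Prod>i\<in>?K. fps_nth \<phi> (g i) * fps_nth \<psi> (?l p i - g i))"
    by (rule prod_sum_PiE) auto
  also have "\<dots> = (\<Sum>(q, r) | q + r = p. monom_coeff \<phi> q * monom_coeff \<psi> r)"
  proof (rule sum.reindex_bij_witness[of _ "\<lambda>(q, r). restrict (?l q) ?K" "\<lambda>g. (Q g, p - Q g)"])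
    fix g assume g: "g \<in> ?G"
    show "(case (Q g, p - Q g) of (q, r) \<Rightarrow> restrict (?l q) ?K) = g"
    proof
      fix i show "(case (Q g, p - Q g) of (q, r) \<Rightarrow> restrict (?l q) ?K) i = g i"
        using PiE_arb[OF g, of i] by (simp add: Q)
    qed
    have le: "?l (Q g) i \<le> ?l p i" for i
      using g by (auto simp: Q PiE_def Pi_def)
    then show "(Q g, p - Q g) \<in> {(q, r). q + r = p}"
      by (auto intro!: poly_mapping_eqI simp: lookup_add lookup_minus)
    have K: "Poly_Mapping.keys (Q g) \<subseteq> ?K" "Poly_Mapping.keys (p - Q g) \<subseteq> ?K"
      by (auto simp: in_keys_iff lookup_minus Q split: if_splits)
    show "(case (Q g, p - Q g) of (q, r) \<Rightarrow> monom_coeff \<phi> q * monom_coeff \<psi> r)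
        = (\<Prod>i\<in>?K. fps_nth \<phi> (g i) * fps_nth \<psi> (?l p i - g i))"
      using assms K by (simp add: monom_coeff_superset[of _ ?K] lookup_minus Q prod.distrib)
  next
    fix x assume "x \<in> {(q, r). q + r = p}"
    then obtain q r where x: "x = (q, r)" "p = q + r" by auto
    have "?l q i = 0" if "i \<notin> ?K" for i
      using that x by (simp add: in_keys_iff lookup_add)
    then have "Q (restrict (?l q) ?K) = q"
      by (intro poly_mapping_eqI) (simp add: Q)
    with x show "(Q (case x of (q, r) \<Rightarrow> restrict (?l q) ?K), p - Q (case x of (q, r) \<Rightarrow> restrict (?l q) ?K)) = x"
      by simp
    show "(case x of (q, r) \<Rightarrow> restrict (?l q) ?K) \<in> ?G"
      using x by (auto simp: lookup_add)
  qed
  finally show ?thesis .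
qed

text \<open>
  The infinite product itself, with an additional variable that records the degree.
\<close>

definition mult_series :: "'a::comm_ring_1 fps \<Rightarrow> 'a symfun fps" where
  "mult_series \<phi> = Abs_fps (mult_seq \<phi>)"

lemma mult_series_nth [simp]: "fps_nth (mult_series \<phi>) k = mult_seq \<phi> k"
  by (simp add: mult_series_def)

lemma mult_series_mult:
  assumes "fps_nth \<phi> 0 = 1" "fps_nth \<psi> 0 = 1"
  shows "mult_series (\<phi> * \<psi>) = mult_series \<phi> * mult_series \<psi>"
proof (rule fps_ext, rule sf_eqI)
  fix k and p :: monom
  let ?D = "{(q, r). q + r = p}"
  have "sf_coeff (fps_nth (mult_series \<phi> * mult_series \<psi>) k) p
      = (\<Sum>i=0..k. \<Sum>x\<in>?D. (if i = mdeg (fst x) then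
          if mdeg p = k then monom_coeff \<phi> (fst x) * monom_coeff \<psi> (snd x) else 0 else 0))"
    unfolding fps_mult_nth sf_coeff_sum sf_coeff_mult
    by (intro sum.cong) (auto simp: sf_coeff_mult_seq mdeg_add)
  also have "\<dots> = (\<Sum>x\<in>?D. \<Sum>i=0..k. (if i = mdeg (fst x) then
          if mdeg p = k then monom_coeff \<phi> (fst x) * monom_coeff \<psi> (snd x) else 0 else 0))"
    by (rule sum.swap)
  also have "\<dots> = (\<Sum>x\<in>?D. if mdeg p = k then monom_coeff \<phi> (fst x) * monom_coeff \<psi> (snd x) else 0)"
    by (intro sum.cong) (auto simp: mdeg_add)
  also have "\<dots> = sf_coeff (mult_seq (\<phi> * \<psi>) k) p"
    by (auto simp: sf_coeff_mult_seq monom_coeff_mult[OF assms] case_prod_unfold)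
  finally show "sf_coeff (fps_nth (mult_series (\<phi> * \<psi>)) k) p
      = sf_coeff (fps_nth (mult_series \<phi> * mult_series \<psi>) k) p" by simp
qed

lemma mult_series_1: "mult_series (1 :: 'a::comm_ring_1 fps) = 1"
proof (rule fps_ext, rule sf_eqI)
  fix k and p :: monom
  show "sf_coeff (fps_nth (mult_series (1 :: 'a fps)) k) p = sf_coeff (fps_nth 1 k) p"
  proof (cases "p = 0")
    case True
    then show ?thesis
      by (auto simp: sf_coeff_mult_seq sf_coeff_1 sf_coeff_0 monom_coeff_altdef)
  next
    case False
    then obtain i where "i \<in> Poly_Mapping.keys p" by fastforce
    then have "monom_coeff 1 p = (0 :: 'a)"
      unfolding monom_coeff_altdef by (intro prod_zero) (auto simp: in_keys_iff)
    with False show ?thesis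
      by (auto simp: sf_coeff_mult_seq sf_coeff_1 sf_coeff_0)
  qed
qed

lemma mult_seq_e: "mult_seq (1 + fps_const y * fps_X) k = sf_scale (y ^ k) (sf_e k)"
proof (rule sf_eqI)
  fix p :: monom
  define \<phi> where "\<phi> = 1 + fps_const y * fps_X"
  have \<phi>: "fps_nth \<phi> n = (if n = 0 then 1 else if n = 1 then y else 0)" for n
    by (cases n) (auto simp: \<phi>_def)
  show "sf_coeff (mult_seq (1 + fps_const y * fps_X) k) p = sf_coeff (sf_scale (y ^ k) (sf_e k)) p"
  proof (cases "\<forall>i. Poly_Mapping.lookup p i \<le> 1")
    case True
    have "fps_nth \<phi> (Poly_Mapping.lookup p i) = y ^ Poly_Mapping.lookup p i" for i
    proof -
      have "Poly_Mapping.lookup p i = 0 \<or> Poly_Mapping.lookup p i = 1"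
        using True by (simp add: le_Suc_eq)
      then show ?thesis by (elim disjE) (simp_all add: \<phi>)
    qed
    then have "monom_coeff \<phi> p = y ^ mdeg p"
      by (simp only: monom_coeff_altdef mdeg_def power_sum)
    with True show ?thesis
      by (simp add: sf_coeff_mult_seq sf_coeff_scale sf_coeff_e \<phi>_def)
  next
    case False
    then obtain i where i: "Poly_Mapping.lookup p i > 1" by (auto simp: not_le)
    then have "fps_nth \<phi> (Poly_Mapping.lookup p i) = 0" "i \<in> Poly_Mapping.keys p"
      by (simp_all add: \<phi> in_keys_iff)
    then have "monom_coeff \<phi> p = 0"
      unfolding monom_coeff_altdef by (intro prod_zero) auto
    with False show ?thesis
      by (auto simp: sf_coeff_mult_seq sf_coeff_scale sf_coeff_e \<phi>_def)
  qed
qed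

lemma mult_seq_h: "mult_seq (Abs_fps (\<lambda>n. y ^ n)) k = sf_scale (y ^ k) (sf_h k)"
  by (rule sf_eqI)
    (auto simp: sf_coeff_mult_seq sf_coeff_scale sf_coeff_h monom_coeff_altdef mdeg_def power_sum)

lemma geometric_mult: "Abs_fps (\<lambda>n. y ^ n) * (1 - fps_const y * fps_X) = (1 :: 'a::comm_ring_1 fps)"
proof (rule fps_ext)
  fix n
  have "Abs_fps (\<lambda>n. y ^ n) * (1 - fps_const y * fps_X)
      = Abs_fps (\<lambda>n. y ^ n) - fps_const y * (fps_X * Abs_fps (\<lambda>n. y ^ n))"
    by (simp add: algebra_simps)
  then show "fps_nth (Abs_fps (\<lambda>n. y ^ n) * (1 - fps_const y * fps_X)) n = fps_nth 1 n"
    by (cases n) simp_all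
qed

text \<open>
  Here \<open>\<omega>\<close> turns the generating function of the \<open>e\<^sub>k\<close> into that of the \<open>h\<^sub>k\<close>, which is the
  multiplicative sequence of a geometric series.
\<close>

lemma mult_series_omega_linear:
  "fps_map omega_gen (mult_series (1 + fps_const y * fps_X)) * mult_series (1 - fps_const y * fps_X) = 1"
proof -
  have "fps_map omega_gen (mult_series (1 + fps_const y * fps_X)) = mult_series (Abs_fps (\<lambda>n. y ^ n))"
    by (simp add: fps_eq_iff mult_seq_e mult_seq_h omega_gen_scale omega_gen_e)
  then show ?thesis
    by (simp add: mult_series_1 geometric_mult flip: mult_series_mult)
qed

text \<open>
  Stated as a product equal to 1 rather than with an inverse, the claim is visibly multiplicative in
  \<open>p\<close>. Splitting off one root at a time reduces it to the linear case.
\<close>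

lemma mult_series_omega_poly:
  fixes p :: "complex poly"
  assumes "coeff p 0 = 1"
  shows "fps_map omega_gen (mult_series (fps_of_poly p)) * mult_series (fps_of_poly p oo (- fps_X)) = 1"
  using assms
proof (induction "degree p" arbitrary: p rule: less_induct)
  case less
  interpret W: ring_map "fps_map (omega_gen :: complex symfun \<Rightarrow> _)"
    by (rule omega_gen.ring_map_fps_map)
  show ?case
  proof (cases "degree p = 0")
    case True
    with less.prems have "p = 1" by (auto elim!: degree_eq_zeroE simp: one_pCons)
    then show ?thesis by (simp add: mult_series_1 W.map_1)
  next
    case False
    then obtain r where r: "poly p r = 0"
      using fundamental_theorem_of_algebra[of p] by (auto simp: constant_degree)
    with less.prems have "r \<noteq> 0" by (auto simp: poly_0_coeff_0)
    from r obtain q where "p = [:- r, 1:] * q" by (auto simp: poly_eq_0_iff_dvd)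
    \<comment> \<open>both factors are rescaled to constant term 1\<close>
    define y q' where "y = - 1 / r" and "q' = smult (- r) q"
    have "[:- r, 1:] = smult (- r) [:1, y:]" using \<open>r \<noteq> 0\<close> by (simp add: y_def)
    with \<open>p = _\<close> have p: "p = [:1, y:] * q'"
      by (simp only: q'_def mult_smult_left mult_smult_right)
    have q': "coeff q' 0 = 1" using less.prems by (simp add: p coeff_mult)
    then have "q' \<noteq> 0" by auto
    have "[:1, y:] \<noteq> 0" "degree [:1, y:] = 1" using \<open>r \<noteq> 0\<close> by (auto simp: y_def)
    then have "degree p = Suc (degree q')"
      unfolding p using \<open>q' \<noteq> 0\<close> by (subst degree_mult_eq) auto
    then have IH: "fps_map omega_gen (mult_series (fps_of_poly q')) * mult_series (fps_of_poly q' oo (- fps_X)) = 1"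
      using less.hyps[of q'] q' by simp
    have lin: "fps_of_poly [:1, y:] = 1 + fps_const y * fps_X"
      by (simp add: fps_of_poly_pCons fps_of_poly_const)
    have lin': "(1 + fps_const y * fps_X) oo (- fps_X) = 1 - fps_const y * fps_X"
    proof (rule fps_ext)
      fix n
      show "fps_nth ((1 + fps_const y * fps_X) oo (- fps_X)) n = fps_nth (1 - fps_const y * fps_X) n"
        by (cases "n = 0 \<or> n = 1") (auto simp: fps_compose_uminus')
    qed
    have eq: "fps_of_poly p = (1 + fps_const y * fps_X) * fps_of_poly q'"
      by (simp only: p fps_of_poly_mult lin)
    have eq': "fps_of_poly p oo (- fps_X) = (1 - fps_const y * fps_X) * (fps_of_poly q' oo (- fps_X))"
      unfolding eq by (subst fps_compose_mult_distrib) (simp_all add: lin')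
    have "fps_map omega_gen (mult_series (fps_of_poly p)) * mult_series (fps_of_poly p oo (- fps_X))
      = (fps_map omega_gen (mult_series (1 + fps_const y * fps_X)) * mult_series (1 - fps_const y * fps_X))
        * (fps_map omega_gen (mult_series (fps_of_poly q')) * mult_series (fps_of_poly q' oo (- fps_X)))"
      unfolding eq' unfolding eq using q'
      by (subst (1 2) mult_series_mult) (simp_all add: W.map_mult mult_ac)
    then show ?thesis using IH by (simp add: mult_series_omega_linear)
  qed
qed

text \<open>
  In each degree only finitely many coefficients of \<open>\<phi>\<close> matter.
\<close>

lemma mult_series_omega:
  fixes \<phi> :: "complex fps"
  assumes "fps_nth \<phi> 0 = 1"
  shows "fps_map omega_gen (mult_series \<phi>) * mult_series (\<phi> oo (- fps_X)) = 1"
proof (rule fps_ext)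
  fix k
  \<comment> \<open>the truncation of \<open>\<phi>\<close> after degree \<open>k\<close>\<close>
  define p where "p = Poly (map (fps_nth \<phi>) [0..<Suc k])"
  have coeff_p: "coeff p n = fps_nth \<phi> n" if "n \<le> k" for n
    using that by (simp add: p_def nth_default_def del: upt_Suc)
  have 1: "mult_seq \<phi> i = mult_seq (fps_of_poly p) i" if "i \<le> k" for i
    using that by (intro mult_seq_cong) (simp add: coeff_p)
  have 2: "mult_seq (\<phi> oo (- fps_X)) i = mult_seq (fps_of_poly p oo (- fps_X)) i" if "i \<le> k" for i
    using that by (intro mult_seq_cong) (simp add: coeff_p fps_compose_uminus')
  have "fps_nth (fps_map omega_gen (mult_series \<phi>) * mult_series (\<phi> oo (- fps_X))) k
    = fps_nth (fps_map omega_gen (mult_series (fps_of_poly p)) * mult_series (fps_of_poly p oo (- fps_X))) k"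
    unfolding fps_mult_nth by (intro sum.cong) (simp_all add: 1 2)
  then show "fps_nth (fps_map omega_gen (mult_series \<phi>) * mult_series (\<phi> oo (- fps_X))) k = fps_nth 1 k"
    using assms coeff_p[of 0] by (simp only: mult_series_omega_poly)
qed

text \<open>
  The image of the multiplicative sequence of \<open>\<phi>\<close> and the one of \<open>\<psi>\<close> are both inverse to that of
  \<open>\<phi>(-X)\<close>.
\<close>

lemma omega_mult_seq:
  fixes \<phi> \<psi> :: "complex fps"
  assumes "fps_nth \<phi> 0 = 1" "(\<phi> oo (- fps_X)) * \<psi> = 1"
  shows "omega_gen (mult_seq \<phi> k) = mult_seq \<psi> k"
proof -
  have "fps_nth ((\<phi> oo (- fps_X)) * \<psi>) 0 = 1" by (simp add: assms(2))
  then have "fps_nth \<psi> 0 = 1" using assms(1) by simp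
  have "fps_map omega_gen (mult_series \<phi>)
      = fps_map omega_gen (mult_series \<phi>) * mult_series ((\<phi> oo (- fps_X)) * \<psi>)"
    by (simp add: assms mult_series_1)
  also have "\<dots> = mult_series \<psi>"
    using assms(1) \<open>fps_nth \<psi> 0 = 1\<close>
    by (subst mult_series_mult) (simp_all add: mult_series_omega flip: mult.assoc)
  finally have "fps_nth (fps_map omega_gen (mult_series \<phi>)) k = fps_nth (mult_series \<psi>) k"
    by simp
  then show ?thesis by simp
qed

lemma mult_seq_eq_sum_m:
  "mult_seq \<phi> k = (\<Sum>\<mu>\<in>partitions k. sf_scale (\<Prod>i\<in>#\<mu>. fps_nth \<phi> i) (sf_m \<mu>))"
proof (rule sf_eqI)
  fix p
  have "0 \<notin># mshape p" by (auto simp: mshape_def in_keys_iff)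
  then have "mshape p \<in> partitions k \<longleftrightarrow> mdeg p = k"
    by (simp add: partitions_def sum_mset_mshape)
  then show "sf_coeff (mult_seq \<phi> k) p
      = sf_coeff (\<Sum>\<mu>\<in>partitions k. sf_scale (\<Prod>i\<in>#\<mu>. fps_nth \<phi> i) (sf_m \<mu>)) p"
    by (simp add: sf_coeff_sum sf_coeff_scale sf_coeff_m sf_coeff_mult_seq monom_coeff_def
        finite_partitions if_distrib[of "(*) _"] cong: if_cong)
qed

lemma ring_map_of_rat: "ring_map (of_rat :: rat \<Rightarrow> complex)"
  by unfold_locales (auto simp: of_rat_add of_rat_mult)

interpretation of_rat: ring_map "of_rat :: rat \<Rightarrow> complex"
  by (rule ring_map_of_rat)

text \<open>
  The left-hand side is \<open>\<omega>\<close> applied to the multiplicative sequence of \<open>\<phi>\<close>. The equation is tested on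
  coefficients after embedding the rationals into the complex numbers.
\<close>

lemma sum_forgotten:
  fixes \<phi> \<psi> :: "rat fps"
  assumes "fps_nth \<phi> 0 = 1" "(\<phi> oo (- fps_X)) * \<psi> = 1"
  shows "(\<Sum>\<mu>\<in>partitions k. sf_scale (\<Prod>i\<in>#\<mu>. fps_nth \<phi> i) (sf_rat (forgotten \<mu>))) = mult_seq \<psi> k"
    (is "?L = _")
proof (rule sf_eqI)
  fix p
  let ?\<phi> = "fps_map of_rat \<phi> :: complex fps" and ?\<psi> = "fps_map of_rat \<psi> :: complex fps"
  interpret F: ring_map "fps_map of_rat :: rat fps \<Rightarrow> complex fps"
    by (rule of_rat.ring_map_fps_map)
  have "(?\<phi> oo (- fps_X)) * ?\<psi> = 1"
    using arg_cong[OF assms(2), of "fps_map of_rat :: rat fps \<Rightarrow> complex fps"]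
    by (simp add: F.map_mult F.map_1 of_rat.fps_map_compose_uminus_X)
  then have "mult_seq ?\<psi> k = omega_gen (mult_seq ?\<phi> k)"
    using assms(1) by (intro omega_mult_seq[symmetric]) auto
  also have "\<dots> = (\<Sum>\<mu>\<in>partitions k. sf_scale (\<Prod>i\<in>#\<mu>. fps_nth ?\<phi> i) (sf_of_int (forgotten \<mu>)))"
    unfolding mult_seq_eq_sum_m forgotten_def sf_of_int_omega
    by (simp add: omega_gen.map_sum omega_gen_scale sf_of_int_m)
  finally have "sf_coeff (mult_seq ?\<psi> k) p = of_rat (sf_coeff ?L p)"
    by (simp add: sf_coeff_sum sf_coeff_scale sf_coeff_of_int of_rat.map_sum of_rat.map_mult
        of_rat.map_prod_mset sf_rat.rep_eq)
  moreover have "sf_coeff (mult_seq ?\<psi> k) p = of_rat (sf_coeff (mult_seq \<psi> k) p)"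
    by (simp add: sf_coeff_mult_seq monom_coeff_def of_rat.map_prod_mset)
  ultimately show "sf_coeff ?L p = sf_coeff (mult_seq \<psi> k) p" by simp
qed


section \<open>Todd symmetric functions as a multiplicative sequence\<close>

text \<open>
  The series \<open>(e\<^sup>X - 1) / X\<close>.
\<close>

definition exp_quotient :: "rat fps" where
  "exp_quotient = Abs_fps (\<lambda>n. 1 / fact (Suc n))"

lemma exp_quotient_0: "fps_nth exp_quotient 0 = 1"
  by (simp add: exp_quotient_def)

lemma exp_quotient_td: "(exp_quotient oo (- fps_X)) * td_series = 1"
proof -
  let ?D = "exp_quotient oo (- fps_X)"
  have "1 - fps_exp (-1) = fps_X * ?D"
  proof (rule fps_ext)
    fix n show "fps_nth (1 - fps_exp (-1)) n = fps_nth (fps_X * ?D) n"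
      by (cases n) (auto simp: fps_compose_uminus' exp_quotient_def algebra_simps)
  qed
  then have "td_series = (fps_X * 1) / (fps_X * ?D)"
    by (simp add: td_series_def)
  also have "\<dots> = 1 / ?D"
    by (rule div_mult_mult1) simp
  finally have "td_series = inverse ?D"
    by (simp add: fps_divide_unit exp_quotient_0)
  then show ?thesis
    using inverse_mult_eq_1'[of ?D] exp_quotient_0 by simp
qed

lemma td_series_0: "fps_nth td_series 0 = 1"
proof -
  have "fps_nth ((exp_quotient oo (- fps_X)) * td_series) 0 = 1"
    by (simp add: exp_quotient_td)
  then show ?thesis by (simp add: exp_quotient_0)
qed

text \<open>
  When the variable with index \<open>n\<close> does not occur in \<open>A\<close>, the exponent \<open>d\<close> of that variable in a
  monomial of the product has to come from the second factor.
\<close>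

lemma lookup_mult_single_keys:
  fixes n j d :: nat
  assumes A: "\<And>a. a \<in> Poly_Mapping.keys A \<Longrightarrow> Poly_Mapping.lookup a n = 0"
    and p0: "Poly_Mapping.lookup p0 n = 0"
  shows "Poly_Mapping.lookup (A * Poly_Mapping.single (Poly_Mapping.single n j) c)
      (p0 + Poly_Mapping.single n d)
    = (if j = d then Poly_Mapping.lookup A p0 * c else (0 :: 'a::comm_ring_1))"
proof -
  let ?m = "Poly_Mapping.single n :: nat \<Rightarrow> monom"
  have iff: "a + ?m j = p0 + ?m d \<longleftrightarrow> a = p0 \<and> j = d" if "a \<in> Poly_Mapping.keys A" for a
  proof
    assume eq: "a + ?m j = p0 + ?m d"
    have "Poly_Mapping.lookup (a + ?m j) n = Poly_Mapping.lookup (p0 + ?m d) n"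
      by (simp only: eq)
    then have "j = d" using A[OF that] p0 by (simp add: lookup_add)
    with eq show "a = p0 \<and> j = d" by simp
  qed simp
  have "A * Poly_Mapping.single (?m j) c
      = (\<Sum>a\<in>Poly_Mapping.keys A. Poly_Mapping.single (a + ?m j) (Poly_Mapping.lookup A a * c))"
    by (subst mpoly_sum_single[of A]) (simp add: sum_distrib_right mult_single)
  then have "Poly_Mapping.lookup (A * Poly_Mapping.single (?m j) c) (p0 + ?m d)
      = (\<Sum>a\<in>Poly_Mapping.keys A. if a = p0 then if j = d then Poly_Mapping.lookup A p0 * c else 0 else 0)"
    unfolding lookup_sum lookup_single by (auto simp: lookup_sum lookup_single when_def iff intro!: sum.cong)
  then show ?thesis by (auto simp: in_keys_iff)
qed

lemma mvar_power: "mvar i ^ j = Poly_Mapping.single (Poly_Mapping.single i j) (1 :: 'a::comm_ring_1)"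
  by (induction j) (simp_all add: mvar_def mult_single flip: single_add)

text \<open>
  Adding one more variable multiplies the coefficient by the Todd coefficient at the exponent of
  that variable; the degree in the remaining variables drops by this exponent.
\<close>

lemma lookup_prod_todd_factor:
  "Poly_Mapping.lookup (fps_nth (\<Prod>i<n. todd_factor (mvar i)) k) p
    = (if Poly_Mapping.keys p \<subseteq> {..<n} \<and> mdeg p = k then monom_coeff td_series p else 0)"
proof (induction n arbitrary: k p)
  case 0
  show ?case
    by (auto simp: lookup_one when_def monom_coeff_altdef)
next
  case (Suc n)
  define d where "d = Poly_Mapping.lookup p n"
  define p0 where "p0 = p - Poly_Mapping.single n d"
  have p0: "Poly_Mapping.lookup p0 i = (if i = n then 0 else Poly_Mapping.lookup p i)" for i
    by (simp add: p0_def d_def lookup_minus lookup_single when_def)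
  have p: "p = p0 + Poly_Mapping.single n d"
    by (rule poly_mapping_eqI) (simp add: p0 d_def lookup_add lookup_single when_def)
  let ?A = "\<lambda>i. fps_nth (\<Prod>i<n. todd_factor (mvar i)) i"
  have A: "Poly_Mapping.lookup a n = 0" if "a \<in> Poly_Mapping.keys (?A i)" for a i
    using that Suc.IH[of i a] by (auto simp: in_keys_iff split: if_splits)
  have "Poly_Mapping.lookup (fps_nth (\<Prod>i<Suc n. todd_factor (mvar i)) k) p
      = (\<Sum>i=0..k. Poly_Mapping.lookup (?A i * Poly_Mapping.single (Poly_Mapping.single n (k - i))
          (fps_nth td_series (k - i))) p)"
    by (simp add: fps_mult_nth lookup_sum todd_factor_def mconst_def mvar_power mult_single)
  also have "\<dots> = (\<Sum>i=0..k. if k - i = d then Poly_Mapping.lookup (?A i) p0 * fps_nth td_series d else 0)"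
    unfolding p by (intro sum.cong refl, subst lookup_mult_single_keys) (auto simp: A p0)
  also have "\<dots> = (\<Sum>i=0..k. if i = k - d then if d \<le> k then Poly_Mapping.lookup (?A i) p0 * fps_nth td_series d else 0 else 0)"
    by (intro sum.cong refl) auto
  also have "\<dots> = (if d \<le> k then Poly_Mapping.lookup (?A (k - d)) p0 * fps_nth td_series d else 0)"
    by simp
  also have "\<dots> = (if Poly_Mapping.keys p0 \<subseteq> {..<n} \<and> mdeg p0 + d = k
      then monom_coeff td_series p0 * fps_nth td_series d else 0)"
    by (auto simp: Suc.IH)
  also have "Poly_Mapping.keys p0 \<subseteq> {..<n} \<longleftrightarrow> Poly_Mapping.keys p \<subseteq> {..<Suc n}"
    by (auto simp: p0 in_keys_iff less_Suc_eq subset_iff)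
  also have "mdeg p0 + d = mdeg p"
    using arg_cong[OF p, of mdeg] by (simp add: mdeg_add) (simp add: mdeg_def)
  also have "(if Poly_Mapping.keys p \<subseteq> {..<Suc n} \<and> mdeg p = k
        then monom_coeff td_series p0 * fps_nth td_series d else 0)
      = (if Poly_Mapping.keys p \<subseteq> {..<Suc n} \<and> mdeg p = k then monom_coeff td_series p else 0)"
  proof (intro if_cong refl)
    assume "Poly_Mapping.keys p \<subseteq> {..<Suc n} \<and> mdeg p = k"
    then have keys: "Poly_Mapping.keys p \<subseteq> {..<Suc n}" ..
    then have "Poly_Mapping.keys p0 \<subseteq> {..<n}"
      by (auto simp: p0 in_keys_iff less_Suc_eq subset_iff)
    then have "monom_coeff td_series p0 = (\<Prod>i<n. fps_nth td_series (Poly_Mapping.lookup p0 i))"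
      by (intro monom_coeff_superset td_series_0) auto
    also have "\<dots> = (\<Prod>i<n. fps_nth td_series (Poly_Mapping.lookup p i))"
      by (intro prod.cong) (auto simp: p0)
    finally show "monom_coeff td_series p0 * fps_nth td_series d = monom_coeff td_series p"
      using monom_coeff_superset[OF td_series_0 _ keys] by (simp add: d_def)
  qed
  finally show ?case .
qed

lemma sf_homogeneous_mult_seq: "sf_homogeneous k (mult_seq \<phi> k)"
  by (simp add: sf_homogeneous_def sf_coeff_mult_seq)

text \<open>
  A monomial of degree \<open>k\<close> has at most \<open>k\<close> variables, so up to a permutation it survives setting
  \<open>x\<^sub>i = 0\<close> for \<open>i > k\<close>.
\<close>

lemma sf_homogeneous_eqI:
  assumes "sf_homogeneous k F" "sf_homogeneous k G" "sf_restrict k F = sf_restrict k G"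
  shows "F = G"
proof (rule sf_eqI_antitone)
  fix p assume "antitone p"
  show "sf_coeff F p = sf_coeff G p"
  proof (cases "mdeg p = k")
    case True
    then have "Poly_Mapping.keys p \<subseteq> {..<k}" using antitone_keys[OF \<open>antitone p\<close>] by simp
    moreover have "Poly_Mapping.lookup (sf_restrict k F) p = Poly_Mapping.lookup (sf_restrict k G) p"
      by (simp add: assms(3))
    ultimately show ?thesis by (simp add: sf_restrict.rep_eq)
  next
    case False
    then show ?thesis using assms(1,2) by (metis sf_homogeneous_def)
  qed
qed

lemma todd_eq_mult_seq: "todd k = mult_seq td_series k"
proof -
  have restrict: "sf_restrict k (mult_seq td_series k) = todd_poly k k"
    by (rule poly_mapping_eqI)
      (simp add: sf_restrict.rep_eq sf_coeff_mult_seq todd_poly_def lookup_prod_todd_factor)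
  show ?thesis
    unfolding todd_def
  proof (rule the_equality)
    show "sf_homogeneous k (mult_seq td_series k) \<and> sf_restrict k (mult_seq td_series k) = todd_poly k k"
      by (simp add: restrict sf_homogeneous_mult_seq)
  next
    fix F assume "sf_homogeneous k F \<and> sf_restrict k F = todd_poly k k"
    then show "F = mult_seq td_series k"
      by (intro sf_homogeneous_eqI[of k]) (simp_all add: restrict sf_homogeneous_mult_seq)
  qed
qed


section \<open>Compositional inverses\<close>

text \<open>
  A left inverse \<open>B\<close> satisfies a triangular linear system, namely \<open>\<Sum>\<^sub>j B\<^sub>j (A\<^sup>j)\<^sub>n = \<delta>\<^sub>n\<^sub>1\<close>
  with \<open>(A\<^sup>j)\<^sub>n = 0\<close> for \<open>j > n\<close> and \<open>(A\<^sup>n)\<^sub>n = 1\<close>, which can be solved over every ring.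
\<close>

fun comp_inv_coeff :: "'a::comm_ring_1 fps \<Rightarrow> nat \<Rightarrow> 'a" where
  "comp_inv_coeff A n = (if n = 1 then 1 else 0) - (\<Sum>j<n. comp_inv_coeff A j * fps_nth (A ^ j) n)"

declare comp_inv_coeff.simps [simp del]

lemma comp_left_inverse_exists:
  fixes A :: "'a::comm_ring_1 fps"
  assumes "fps_nth A 0 = 0" "fps_nth A 1 = 1"
  obtains B where "fps_nth B 0 = 0" "fps_nth B 1 = 1" "B oo A = fps_X"
proof -
  define B where "B = Abs_fps (comp_inv_coeff A)"
  have B0: "fps_nth B 0 = 0" by (simp add: B_def comp_inv_coeff.simps[of A 0])
  have "fps_nth (B oo A) n = fps_nth fps_X n" for n
  proof -
    have "fps_nth (A ^ n) n = 1"
      using startsby_zero_power_nth_same[of A n] assms by simp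
    moreover have "{0..n} = insert n {..<n}" by auto
    ultimately have "fps_nth (B oo A) n = fps_nth B n + (\<Sum>j<n. fps_nth B j * fps_nth (A ^ j) n)"
      by (simp add: fps_compose_nth)
    also have "\<dots> = fps_nth fps_X n"
      unfolding B_def by (simp add: comp_inv_coeff.simps[of A n])
    finally show ?thesis .
  qed
  then have BA: "B oo A = fps_X" by (rule fps_ext)
  have "fps_nth B 1 = 1"
    using comp_inv_coeff.simps[of A 1] B0 by (simp add: B_def)
  with B0 show thesis using BA by (rule that)
qed

text \<open>
  The left inverse has a left inverse itself, and associativity of composition identifies it with
  \<open>A\<close>.
\<close>

lemma comp_left_inverse_is_right_inverse:
  fixes A B :: "'a::idom fps"
  assumes "fps_nth A 0 = 0" "fps_nth A 1 = 1" "fps_nth B 0 = 0" "fps_nth B 1 = 1" "B oo A = fps_X"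
  shows "A oo B = fps_X"
proof -
  obtain A' where A': "A' oo B = fps_X"
    using comp_left_inverse_exists[of B] assms by blast
  have "A' = A' oo (B oo A)" by (simp add: assms(5))
  also have "\<dots> = A' oo B oo A" using assms by (intro fps_compose_assoc) auto
  also have "\<dots> = A" using assms(1) by (simp add: A')
  finally show ?thesis using A' by simp
qed

lemma alpha_nth: "fps_nth alpha n = (if n = 0 then 0 else if n = 1 then 1 else mvar (n - 1))"
  by (simp add: alpha_def)

lemma
  shows beta_0: "fps_nth beta 0 = 0" and beta_comp_alpha: "beta oo alpha = fps_X"
proof -
  obtain B where B: "fps_nth B 0 = 0" "fps_nth B 1 = 1" "B oo alpha = fps_X"
    using comp_left_inverse_exists[of alpha] by (auto simp: alpha_nth)
  have AB: "alpha oo B = fps_X"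
    by (rule comp_left_inverse_is_right_inverse[OF _ _ B]) (simp_all add: alpha_nth)
  have "beta = B"
    unfolding beta_def
  proof (rule the_equality)
    show "fps_nth B 0 = 0 \<and> fps_nth B 1 = 1 \<and> alpha oo B = fps_X \<and> B oo alpha = fps_X"
      using B AB by simp
  next
    fix B' assume B': "fps_nth B' 0 = 0 \<and> fps_nth B' 1 = 1 \<and> alpha oo B' = fps_X \<and> B' oo alpha = fps_X"
    have "B' = B' oo (alpha oo B)" by (simp add: AB)
    also have "\<dots> = B' oo alpha oo B" using B by (intro fps_compose_assoc) (auto simp: alpha_nth)
    also have "\<dots> = B" using B B' by simp
    finally show "B' = B" .
  qed
  with B show "fps_nth beta 0 = 0" "beta oo alpha = fps_X" by auto
qed


section \<open>Isobaric polynomials\<close>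

definition part_monom :: "nat multiset \<Rightarrow> monom" where
  "part_monom \<nu> = (\<Sum>i\<in>#\<nu>. Poly_Mapping.single i 1)"

lemma part_monom_union: "part_monom (\<mu> + \<nu>) = part_monom \<mu> + part_monom \<nu>"
  by (simp add: part_monom_def)

lemma lookup_part_monom: "Poly_Mapping.lookup (part_monom \<nu>) i = count \<nu> i"
  by (induction \<nu>) (auto simp: part_monom_def lookup_add lookup_single)

lemma inj_part_monom: "inj part_monom"
  by (rule injI) (metis lookup_part_monom multiset_eqI)

lemma mpow_part_monom: "mpow v (part_monom \<nu>) = (\<Prod>i\<in>#\<nu>. v i)"
  by (induction \<nu>) (simp_all add: part_monom_def mpow_0 mpow_add mpow_single)

text \<open>
  With weight \<open>n\<close> given to \<open>a\<^sub>n\<close>, an isobaric polynomial of weight \<open>n\<close> is a combination of monomials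
  \<open>a\<^sup>\<nu>\<close> for partitions \<open>\<nu>\<close> of \<open>n\<close>; in particular, the variable with index 0 does not occur. This is
  what allows the evaluation of \<open>b\<^sup>\<mu>\<close> to be written as a sum of its coefficients over partitions.
\<close>

definition isobaric :: "nat \<Rightarrow> 'a::comm_ring_1 mpoly \<Rightarrow> bool" where
  "isobaric n P \<longleftrightarrow> Poly_Mapping.keys P \<subseteq> part_monom ` partitions n"

lemma isobaric_0: "isobaric n 0"
  by (simp add: isobaric_def)

lemma isobaric_1: "isobaric 0 1"
proof -
  have "part_monom {#} \<in> part_monom ` partitions 0"
    by (intro imageI) (simp add: partitions_def)
  then show ?thesis by (simp add: isobaric_def part_monom_def)
qed

lemma isobaric_mvar:
  assumes "n > 0"
  shows "isobaric n (mvar n)"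
proof -
  have "part_monom {#n#} \<in> part_monom ` partitions n"
    using assms by (intro imageI) (simp add: partitions_def)
  then show ?thesis by (simp add: isobaric_def part_monom_def mvar_def)
qed

lemma isobaric_diff: "isobaric n P \<Longrightarrow> isobaric n Q \<Longrightarrow> isobaric n (P - Q)"
  unfolding isobaric_def by (auto simp: in_keys_iff lookup_minus subset_iff) (metis diff_0_right)

lemma isobaric_add: "isobaric n P \<Longrightarrow> isobaric n Q \<Longrightarrow> isobaric n (P + Q)"
  unfolding isobaric_def using Poly_Mapping.keys_add[of P Q] by blast

lemma isobaric_sum: "(\<And>x. x \<in> A \<Longrightarrow> isobaric n (f x)) \<Longrightarrow> isobaric n (sum f A)"
  by (induction A rule: infinite_finite_induct) (auto simp: isobaric_0 isobaric_add)

lemma isobaric_mult: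
  assumes "isobaric m P" "isobaric n Q"
  shows "isobaric (m + n) (P * Q)"
  unfolding isobaric_def
proof
  fix p assume "p \<in> Poly_Mapping.keys (P * Q)"
  then obtain a b where ab: "a \<in> Poly_Mapping.keys P" "b \<in> Poly_Mapping.keys Q" "p = a + b"
    using Poly_Mapping.keys_mult[of P Q] by blast
  then obtain \<mu> \<nu> where "a = part_monom \<mu>" "\<mu> \<in> partitions m" "b = part_monom \<nu>" "\<nu> \<in> partitions n"
    using assms unfolding isobaric_def by blast
  then have "p = part_monom (\<mu> + \<nu>)" "\<mu> + \<nu> \<in> partitions (m + n)"
    using ab by (auto simp: part_monom_union partitions_def)
  then show "p \<in> part_monom ` partitions (m + n)" by blast
qed

lemma isobaric_prod_mset:
  "(\<And>n. isobaric n (f n)) \<Longrightarrow> isobaric (sum_mset \<mu>) (\<Prod>i\<in>#\<mu>. f i)"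
  by (induction \<mu>) (auto simp: isobaric_1 isobaric_mult)

lemma alpha_power_nth_less: "n < j \<Longrightarrow> fps_nth (alpha ^ j) n = 0"
  using startsby_zero_power_prefix[of alpha j] by (simp add: alpha_nth)

lemma isobaric_alpha_power: "j \<le> n \<Longrightarrow> isobaric (n - j) (fps_nth (alpha ^ j) n)"
proof (induction j arbitrary: n)
  case 0
  show ?case by (cases n) (simp_all add: isobaric_0 isobaric_1)
next
  case (Suc j)
  have "isobaric (n - Suc j) (fps_nth alpha i * fps_nth (alpha ^ j) (n - i))" if "i \<le> n" for i
  proof (cases "i = 0 \<or> n - i < j")
    case True
    then show ?thesis by (auto simp: alpha_nth alpha_power_nth_less isobaric_0)
  next
    case False
    have "isobaric (i - 1) (fps_nth alpha i)"
      using False by (auto simp: alpha_nth isobaric_1 isobaric_mvar)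
    moreover have "isobaric (n - i - j) (fps_nth (alpha ^ j) (n - i))"
      using False by (intro Suc.IH) auto
    ultimately have "isobaric ((i - 1) + (n - i - j)) (fps_nth alpha i * fps_nth (alpha ^ j) (n - i))"
      by (rule isobaric_mult)
    moreover have "(i - 1) + (n - i - j) = n - Suc j" using False that by auto
    ultimately show ?thesis by simp
  qed
  then show ?case
    unfolding power_Suc fps_mult_nth by (intro isobaric_sum) simp
qed

text \<open>
  In the linear system that determines the coefficients of \<open>\<beta>\<close> from those of \<open>\<alpha>\<close>, the
  term with index \<open>j\<close> has weight \<open>(j - 1) + (n - j) = n - 1\<close>.
\<close>

lemma isobaric_beta: "n > 0 \<Longrightarrow> isobaric (n - 1) (fps_nth beta n)"
proof (induction n rule: less_induct)
  case (less n)
  have "fps_nth (alpha ^ n) n = 1"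
    using startsby_zero_power_nth_same[of alpha n] by (simp add: alpha_nth)
  moreover have "{0..n} = insert n {..<n}" by auto
  ultimately have "fps_nth fps_X n = fps_nth beta n + (\<Sum>j<n. fps_nth beta j * fps_nth (alpha ^ j) n)"
    by (simp add: fps_compose_nth flip: beta_comp_alpha)
  then have beta: "fps_nth beta n = (if n = 1 then 1 else 0) - (\<Sum>j<n. fps_nth beta j * fps_nth (alpha ^ j) n)"
    by (simp add: eq_diff_eq del: One_nat_def)
  have "isobaric (n - 1) (fps_nth beta j * fps_nth (alpha ^ j) n)" if "j < n" for j
  proof (cases "j = 0")
    case True
    then show ?thesis by (simp add: beta_0 isobaric_0)
  next
    case False
    then have "isobaric ((j - 1) + (n - j)) (fps_nth beta j * fps_nth (alpha ^ j) n)"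
      using that by (intro isobaric_mult less.IH isobaric_alpha_power) auto
    then show ?thesis using False that by simp
  qed
  then show ?case
    unfolding beta by (intro isobaric_diff isobaric_sum) (auto simp: isobaric_0 isobaric_1)
qed

lemma isobaric_b_coeff: "isobaric n (b_coeff n)"
  using isobaric_beta[of "n + 1"] by (simp add: b_coeff_def)

lemma (in ring_map) meval_isobaric:
  assumes "isobaric n P"
  shows "meval f v P
    = (\<Sum>\<nu>\<in>partitions n. f (Poly_Mapping.lookup P (part_monom \<nu>)) * (\<Prod>i\<in>#\<nu>. v i))"
proof -
  have "meval f v P = (\<Sum>a\<in>part_monom ` partitions n. f (Poly_Mapping.lookup P a) * mpow v a)"
    using assms by (intro meval_superset) (auto simp: isobaric_def finite_partitions)
  also have "\<dots> = (\<Sum>\<nu>\<in>partitions n. f (Poly_Mapping.lookup P (part_monom \<nu>)) * (\<Prod>i\<in>#\<nu>. v i))"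
    using inj_part_monom by (subst sum.reindex) (auto simp: mpow_part_monom inj_on_def dest: injD)
  finally show ?thesis .
qed


section \<open>The logarithmic specialisation\<close>

interpretation of_int_rat: ring_map "of_int :: int \<Rightarrow> rat"
  by (rule ring_map_of_int)

lemma (in ring_map) fps_map_compose:
  "fps_map f (A oo B) = fps_map f A oo fps_map f B"
proof -
  interpret F: ring_map "fps_map f" by (rule ring_map_fps_map)
  have "f (fps_nth (B ^ i) n) = fps_nth (fps_map f B ^ i) n" for i n
    by (simp flip: F.map_power)
  then show ?thesis
    by (simp add: fps_eq_iff fps_compose_nth map_sum map_mult)
qed

text \<open>
  Evaluation at \<open>a\<^sub>n = 1/(n + 1)\<close>, which turns \<open>\<alpha>(u)\<close> into \<open>-log(1 - u)\<close>.
\<close>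

definition log_spec :: "int mpoly \<Rightarrow> rat" where
  "log_spec = meval of_int (\<lambda>n. 1 / of_nat (n + 1))"

interpretation log_spec: ring_map log_spec
  unfolding log_spec_def by (rule of_int_rat.ring_map_meval)

text \<open>
  With \<open>E = e\<^sup>-\<^sup>X - 1\<close>, the series \<open>-log(1 - u)\<close> at \<open>u = -E\<close> is \<open>-log(1 + E)\<close>, that is, the
  compositional inverse of \<open>E\<close> evaluated at \<open>E\<close>.
\<close>

lemma log_spec_alpha: "fps_map log_spec alpha oo (1 - fps_exp (-1)) = fps_X"
proof -
  define E :: "rat fps" where "E = fps_exp (-1) - 1"
  have alpha: "fps_nth (fps_map log_spec alpha) n = (if n = 0 then 0 else 1 / of_nat n)" for n
    by (simp add: alpha_nth log_spec.map_0 log_spec.map_1)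
      (simp add: log_spec_def of_int_rat.meval_mvar)
  have pow: "fps_nth ((- E) ^ i) n = (-1) ^ i * fps_nth (E ^ i) n" for i n
    by (cases "even i") simp_all
  have "fps_map log_spec alpha oo (- E) = fps_ln (-1) oo E"
  proof (rule fps_ext)
    fix n
    have "fps_nth (fps_map log_spec alpha) i * fps_nth ((- E) ^ i) n
        = fps_nth (fps_ln (-1)) i * fps_nth (E ^ i) n" for i
      unfolding alpha pow fps_ln_nth by (cases i) simp_all
    then show "fps_nth (fps_map log_spec alpha oo (- E)) n = fps_nth (fps_ln (-1) oo E) n"
      by (simp only: fps_compose_nth)
  qed
  also have "\<dots> = fps_X"
    by (simp add: E_def fps_ln_fps_exp_inv fps_inv_fps_exp_compose)
  finally show ?thesis by (simp add: E_def)
qed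

lemma log_spec_b_coeff: "log_spec (b_coeff n) = (-1) ^ n / fact (n + 1)"
proof -
  define G :: "rat fps" where "G = 1 - fps_exp (-1)"
  let ?\<alpha> = "fps_map log_spec alpha" and ?\<beta> = "fps_map log_spec beta"
  have \<alpha>G: "?\<alpha> oo G = fps_X" unfolding G_def by (rule log_spec_alpha)
  have G0: "fps_nth G 0 = 0" by (simp add: G_def)
  have "?\<beta> oo ?\<alpha> = fps_map log_spec fps_X"
    by (simp add: beta_comp_alpha flip: log_spec.fps_map_compose)
  also have "\<dots> = fps_X"
    by (simp add: fps_eq_iff log_spec.map_0 log_spec.map_1)
  finally have \<beta>\<alpha>: "?\<beta> oo ?\<alpha> = fps_X" .
  have "?\<beta> = ?\<beta> oo (?\<alpha> oo G)" by (simp add: \<alpha>G)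
  also have "\<dots> = ?\<beta> oo ?\<alpha> oo G"
    using G0 by (intro fps_compose_assoc) (auto simp: alpha_nth log_spec.map_0)
  also have "\<dots> = G" using G0 by (simp add: \<beta>\<alpha>)
  finally have "fps_nth ?\<beta> (n + 1) = fps_nth G (n + 1)" by simp
  then show ?thesis by (simp add: b_coeff_def G_def algebra_simps)
qed

text \<open>
  Both sides are the value of \<open>b\<^sup>\<mu>\<close> under the logarithmic specialisation.
\<close>

lemma sum_C_coeff:
  assumes "\<mu> \<in> partitions k"
  shows "(\<Sum>\<nu>\<in>partitions k. of_int (C_coeff \<mu> \<nu>) / (\<Prod>i\<in>#\<nu>. of_nat (i + 1)))
    = (-1) ^ k * (\<Prod>i\<in>#\<mu>. fps_nth exp_quotient i)"
proof -
  have k: "sum_mset \<mu> = k" using assms by (simp add: partitions_def)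
  have inv: "(\<Prod>i\<in>#\<nu>. 1 / of_nat (i + 1)) = 1 / (\<Prod>i\<in>#\<nu>. of_nat (i + 1) :: rat)" for \<nu>
    by (induction \<nu>) simp_all
  have "isobaric k (\<Prod>i\<in>#\<mu>. b_coeff i)"
    using isobaric_prod_mset[of b_coeff \<mu>] isobaric_b_coeff k by simp
  then have "log_spec (\<Prod>i\<in>#\<mu>. b_coeff i)
      = (\<Sum>\<nu>\<in>partitions k. of_int (C_coeff \<mu> \<nu>) * (\<Prod>i\<in>#\<nu>. 1 / of_nat (i + 1)))"
    unfolding log_spec_def C_coeff_def part_monom_def[symmetric] by (rule of_int_rat.meval_isobaric)
  then have "(\<Sum>\<nu>\<in>partitions k. of_int (C_coeff \<mu> \<nu>) / (\<Prod>i\<in>#\<nu>. of_nat (i + 1)))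
      = (\<Prod>i\<in>#\<mu>. log_spec (b_coeff i))"
    by (simp only: inv log_spec.map_prod_mset) simp
  also have "\<dots> = (-1) ^ sum_mset \<mu> * (\<Prod>i\<in>#\<mu>. fps_nth exp_quotient i)"
    by (induction \<mu>) (simp_all add: log_spec_b_coeff exp_quotient_def power_add)
  finally show ?thesis by (simp add: k)
qed

theorem theorem3p2:
  fixes k :: nat
  shows "todd k = (-1) ^ k *
    (\<Sum>\<nu>\<in>partitions k. sf_scale (1 / (\<Prod>i\<in>#\<nu>. of_nat (i + 1))) (sf_rat (g_sym \<nu>)))"
proof -
  have sign: "(-1) ^ k * F = sf_scale ((-1) ^ k) F" for F :: "rat symfun"
    by (simp add: scale.map_power scale.map_uminus scale.map_1 flip: sf_scale_eq_mult[of "(-1) ^ k" F])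
  let ?T = "\<Sum>\<nu>\<in>partitions k. sf_scale (1 / (\<Prod>i\<in>#\<nu>. of_nat (i + 1))) (sf_rat (g_sym \<nu>))"
  have g: "sf_coeff (g_sym \<nu>) p = (\<Sum>\<mu>\<in>partitions k. C_coeff \<mu> \<nu> * sf_coeff (forgotten \<mu>) p)"
    if "\<nu> \<in> partitions k" for \<nu> p
    using that by (simp add: g_sym_def partitions_def sf_coeff_sum sf_coeff_scale flip: sf_scale_int)
  have "sf_coeff ?T p = (-1) ^ k * sf_coeff (todd k) p" for p
  proof -
    have "sf_coeff ?T p = (\<Sum>\<nu>\<in>partitions k. \<Sum>\<mu>\<in>partitions k.
        of_int (C_coeff \<mu> \<nu>) / (\<Prod>i\<in>#\<nu>. of_nat (i + 1)) * of_int (sf_coeff (forgotten \<mu>) p))"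
      by (simp add: sf_coeff_sum sf_coeff_scale sf_rat.rep_eq g sum_divide_distrib)
    also have "\<dots> = (\<Sum>\<mu>\<in>partitions k. (\<Sum>\<nu>\<in>partitions k.
        of_int (C_coeff \<mu> \<nu>) / (\<Prod>i\<in>#\<nu>. of_nat (i + 1))) * of_int (sf_coeff (forgotten \<mu>) p))"
      by (subst sum.swap) (simp only: sum_distrib_right)
    also have "\<dots> = (\<Sum>\<mu>\<in>partitions k. (-1) ^ k * (\<Prod>i\<in>#\<mu>. fps_nth exp_quotient i)
        * of_int (sf_coeff (forgotten \<mu>) p))"
      by (simp only: sum_C_coeff cong: sum.cong)
    also have "\<dots> = (-1) ^ k * sf_coeff (\<Sum>\<mu>\<in>partitions k.
        sf_scale (\<Prod>i\<in>#\<mu>. fps_nth exp_quotient i) (sf_rat (forgotten \<mu>))) p"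
      by (simp add: sf_coeff_sum sf_coeff_scale sf_rat.rep_eq sum_distrib_left mult.assoc)
    also have "\<dots> = (-1) ^ k * sf_coeff (todd k) p"
      using sum_forgotten[OF _ exp_quotient_td, of k] by (simp add: exp_quotient_0 todd_eq_mult_seq)
    finally show ?thesis .
  qed
  then have "sf_coeff (sf_scale ((-1) ^ k) ?T) p = sf_coeff (todd k) p" for p
    by (simp add: sf_coeff_scale flip: mult.assoc power_add)
  then show ?thesis
    unfolding sign by (intro sf_eqI) simp
qed

end
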